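(* Let $\alpha,\beta\in(0,1]$, $\lambda,\mu>0$, and let ${}_4Q$ be the restless Mittag-Leffler queue with orders $\alpha,\beta$ and rates $\lambda,\mu$. Then for every $n\ge1$ and $t\ge0$, $$\mathbb{P}(S_n>t\mid A_n,D_{n-1})=\begin{cases}E_\beta(-\mu t^\beta)& A_n<D_{n-1},\\ F_t(A_n-D_{n-1})& A_n\ge D_{n-1},\end{cases}$$ where $$F_t(T)=\int_{[0,T]}\frac{E_\beta(-\mu(T-s+t)^\beta)}{E_\beta(-\mu(T-s)^\beta)}\,dF_{\mathsf{LJ}}(s;\beta,\mu,T)$$ and $F_{\mathsf{LJ}}(s;\beta,\mu,T)$ is defined, for $0\le s\le T$, by $$F_{\mathsf{LJ}}(s;\beta,\mu,T)=E_\beta(-\mu T^\beta)+\sum_{n=1}^{+\infty}\beta n\mu^n\int_0^sE_\beta(-\mu(T-z)^\beta)z^{n\beta-1}E_{\beta,n\beta+1}^{n+1}(-\mu z^\beta)\,dz,$$ while $F_{\mathsf{LJ}}(s;\beta,\mu,T)=1$ for $s\ge T$.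
   Context: $E_\alpha(x)=\sum_{k\ge0} x^k/\Gamma(\alpha k+1)$ is the Mittag-Leffler function and $E_{\alpha,\beta}^{\gamma}(z)=\sum_{k\ge0}\frac{\Gamma(\gamma+k)z^k}{\Gamma(\gamma)k!\,\Gamma(\alpha k+\beta)}$ is the Prabhakar function. $X\sim\mathsf{ML}_\alpha(\lambda)$ means $X\ge0$ and $\mathbb{P}(X>t)=E_\alpha(-\lambda t^\alpha)$ for $t\ge 0$. A fractional Poisson process of order $\alpha\in(0,1]$ and rate $\lambda>0$ is the renewal counting process $N(t)=\max\{k\ge0:\sum_{j=1}^kY_j\le t\}$ with $(Y_j)$ i.i.d. $\mathsf{ML}_\alpha(\lambda)$. The restless Mittag-Leffler queue has queue length process ${}_4Q=\Phi(N^{\mathsf a}-N^{\mathsf d})$, where $N^{\mathsf a}$ and $N^{\mathsf d}$ are independent fractional Poisson processes of orders $\alpha,\beta$ and rates $\lambda,\mu$ respectively, and $\Phi(f)(t)=f(t)+\sup_{0\le s\le t}\max\{-f(s),0\}$ is the Skorokhod reflection map. Arrival and departure times: $A_0=D_0=0$, $A_n=\min\{t>A_{n-1}:{}_4Q(t)={}_4Q(t-)+1\}$, $D_n=\min\{t>D_{n-1}:{}_4Q(t)={}_4Q(t-)-1\}$ for $n\ge1$. Service times: $S_n=D_n-\max\{D_{n-1},A_n\}$. The integral in $F_t(T)$ is a Lebesgue–Stieltjes integral with respect to the law on $[0,T]$ with distribution function $s\mapsto F_{\mathsf{LJ}}(s;\beta,\mu,T)$ (including its atom at $s=0$). *)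

theory Defs
  imports "HOL-Probability.Probability"
begin

definition mittag_leffler :: "real \<Rightarrow> real \<Rightarrow> real" where
  "mittag_leffler \<alpha> x = (\<Sum>k. x ^ k / Gamma (\<alpha> * real k + 1))"

definition prabhakar :: "real \<Rightarrow> real \<Rightarrow> real \<Rightarrow> real \<Rightarrow> real" where
  "prabhakar \<alpha> \<beta> \<gamma> z =
     (\<Sum>k. Gamma (\<gamma> + real k) * z ^ k / (Gamma \<gamma> * fact k * Gamma (\<alpha> * real k + \<beta>)))"

definition mittag_leffler_distributed :: "'a measure \<Rightarrow> real \<Rightarrow> real \<Rightarrow> ('a \<Rightarrow> real) \<Rightarrow> bool" where
  "mittag_leffler_distributed M \<alpha> r X \<longleftrightarrow>
     X \<in> borel_measurable M \<and> (AE \<omega> in M. 0 \<le> X \<omega>) \<and>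
     (\<forall>t\<ge>0. measure M {\<omega>\<in>space M. X \<omega> > t} = mittag_leffler \<alpha> (- r * t powr \<alpha>))"

text \<open>
  The variables \<open>Y j\<close> are indexed by \<open>j \<ge> 1\<close>. The renewal representation is required almost surely
  (outside one null set, for all times simultaneously): on a null set the partial sums may stay
  bounded, and the maximum need not exist there.
\<close>

definition fractional_poisson_process ::
    "'a measure \<Rightarrow> real \<Rightarrow> real \<Rightarrow> (real \<Rightarrow> 'a \<Rightarrow> nat) \<Rightarrow> bool" where
  "fractional_poisson_process M \<alpha> r N \<longleftrightarrow>
     (\<exists>Y :: nat \<Rightarrow> 'a \<Rightarrow> real.
        prob_space.indep_vars M (\<lambda>_. borel) Y {1..} \<and>
        (\<forall>j\<ge>1. mittag_leffler_distributed M \<alpha> r (Y j)) \<and>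
        (AE \<omega> in M. \<forall>t\<ge>0. N t \<omega> = Max {k. (\<Sum>j=1..k. Y j \<omega>) \<le> t}))"

definition skorokhod_reflection :: "(real \<Rightarrow> real) \<Rightarrow> real \<Rightarrow> real" where
  "skorokhod_reflection f t = f t + (SUP s\<in>{0..t}. max (- f s) 0)"

text \<open>
  Independence of the two processes means independence of their restrictions to times \<open>t \<ge> 0\<close>,
  regarded as random elements of the product space \<open>\<nat> ^ [0,\<infinity>)\<close>.
\<close>

definition restless_ML_queue ::
    "'a measure \<Rightarrow> real \<Rightarrow> real \<Rightarrow> real \<Rightarrow> real \<Rightarrow> (real \<Rightarrow> 'a \<Rightarrow> real) \<Rightarrow> bool" where
  "restless_ML_queue M \<alpha> \<beta> lam \<mu> Q \<longleftrightarrow>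
     (\<exists>Na Nd.
        fractional_poisson_process M \<alpha> lam Na \<and>
        fractional_poisson_process M \<beta> \<mu> Nd \<and>
        prob_space.indep_var M
          (Pi\<^sub>M {0..} (\<lambda>_. count_space UNIV)) (\<lambda>\<omega>. \<lambda>t\<in>{0..}. Na t \<omega>)
          (Pi\<^sub>M {0..} (\<lambda>_. count_space UNIV)) (\<lambda>\<omega>. \<lambda>t\<in>{0..}. Nd t \<omega>) \<and>
        (\<forall>\<omega>\<in>space M. \<forall>t\<ge>0.
           Q t \<omega> = skorokhod_reflection (\<lambda>s. real (Na s \<omega>) - real (Nd s \<omega>)) t))"

text \<open>
  \<open>Lim (at_left t) q\<close> is the left limit \<open>q(t-)\<close>. The minima exist almost surely for the restless
  queue.
\<close>

primrec arrival_time :: "(real \<Rightarrow> 'a \<Rightarrow> real) \<Rightarrow> nat \<Rightarrow> 'a \<Rightarrow> real" where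
  "arrival_time Q 0 \<omega> = 0"
| "arrival_time Q (Suc n) \<omega> =
     (LEAST t. t > arrival_time Q n \<omega> \<and> Q t \<omega> = Lim (at_left t) (\<lambda>s. Q s \<omega>) + 1)"

primrec departure_time :: "(real \<Rightarrow> 'a \<Rightarrow> real) \<Rightarrow> nat \<Rightarrow> 'a \<Rightarrow> real" where
  "departure_time Q 0 \<omega> = 0"
| "departure_time Q (Suc n) \<omega> =
     (LEAST t. t > departure_time Q n \<omega> \<and> Q t \<omega> = Lim (at_left t) (\<lambda>s. Q s \<omega>) - 1)"

definition service_time :: "(real \<Rightarrow> 'a \<Rightarrow> real) \<Rightarrow> nat \<Rightarrow> 'a \<Rightarrow> real" where
  "service_time Q n \<omega> =
     departure_time Q n \<omega> - max (departure_time Q (n - 1) \<omega>) (arrival_time Q n \<omega>)"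

text \<open>
  The value \<open>0\<close> for \<open>s < 0\<close> makes the jump of size \<open>E\<^sub>\<beta>(-\<mu> T\<^sup>\<beta>)\<close> at \<open>s = 0\<close> an atom of
  the associated \<^const>\<open>interval_measure\<close>. The summation index is shifted to start at \<open>0\<close>.
\<close>

definition F_LJ :: "real \<Rightarrow> real \<Rightarrow> real \<Rightarrow> real \<Rightarrow> real" where
  "F_LJ \<beta> \<mu> T s =
     (if s < 0 then 0
      else if s < T then
        mittag_leffler \<beta> (- \<mu> * T powr \<beta>) +
        (\<Sum>m. let n = Suc m in
           \<beta> * real n * \<mu> ^ n *
           (LBINT z:{0..s}. mittag_leffler \<beta> (- \<mu> * (T - z) powr \<beta>) *
              z powr (real n * \<beta> - 1) *
              prabhakar \<beta> (real n * \<beta> + 1) (real n + 1) (- \<mu> * z powr \<beta>)))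
      else 1)"

definition residual_tail :: "real \<Rightarrow> real \<Rightarrow> real \<Rightarrow> real \<Rightarrow> real" where
  "residual_tail \<beta> \<mu> t T =
     (LINT s:{0..T}|interval_measure (F_LJ \<beta> \<mu> T).
        mittag_leffler \<beta> (- \<mu> * (T - s + t) powr \<beta>) /
        mittag_leffler \<beta> (- \<mu> * (T - s) powr \<beta>))"

text \<open>
  Conditional probability given the sigma-algebra generated by \<open>X\<close>. It is taken in the completion
  of \<open>M\<close>, so that variables which are determined only up to a null set (such as the arrival and
  departure times) are measurable; for \<open>M\<close>-measurable data this agrees almost surely with the
  conditional probability in \<open>M\<close>.
\<close>

definition cond_prob_given ::
    "'a measure \<Rightarrow> ('a \<Rightarrow> 'b::topological_space) \<Rightarrow> ('a \<Rightarrow> bool) \<Rightarrow> 'a \<Rightarrow> real" where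
  "cond_prob_given M X P =
     real_cond_exp (completion M) (vimage_algebra (space M) X borel)
       (indicator {\<omega>\<in>space M. P \<omega>})"

end

theory Submission
  imports Defs
begin

text \<open>
  The departure opportunities are the epochs \<open>d k\<close> of a renewal process that is independent of the
  arrivals, and each opportunity is used iff the queue is not empty. Hence \<open>D\<^sub>n\<close> is the first
  opportunity after \<open>max D\<^sub>n\<^sub>-\<^sub>1 A\<^sub>n\<close>, and the event that \<open>D\<^sub>n\<^sub>-\<^sub>1\<close> is the \<open>k\<close>-th opportunity depends only
  on the arrivals and the first \<open>k\<close> gaps. The gaps after the \<open>k\<close>-th opportunity are a fresh copy of
  the renewal process, so given \<open>A\<^sub>n\<close> and \<open>D\<^sub>n\<^sub>-\<^sub>1\<close> the service time is the residual life of that copy at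
  time \<open>max (A\<^sub>n - D\<^sub>n\<^sub>-\<^sub>1) 0\<close>. Decomposing according to the last epoch before this time gives the
  integral of \<^const>\<open>residual_tail\<close>, provided that \<^const>\<open>F_LJ\<close> is the distribution function of that
  epoch. This is so because the \<open>n\<close>-fold convolution of the Mittag-Leffler density is a Prabhakar
  function, by the convolution identity for the powers \<open>x powr (a - 1) / Gamma a\<close>.
\<close>

section \<open>Convolution powers of the Mittag-Leffler density\<close>

text \<open>Three obstacles shape the proof. Independence is assumed for the counting processes, not
  for their gaps, so epochs and gaps are recovered as measurable functionals of the paths before any
  product space is used. The index of the opportunity that realises the (n-1)-st departure is random
  and depends on the arrivals; splitting over its countably many values makes it a fixed
  \<open>k\<close>, and the later gaps are then resampled for a fixed arrival path. Arrival and
  departure times are defined through jumps of the queue length, and an arrival that coincides with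
  an opportunity would cancel in the difference of the counting processes without any jump; such
  ties are null because the epochs have densities.

  On the analytic side the series alternate, so positivity and decay of the Mittag-Leffler tail are
  not visible in them; both are drawn from the existence of a law with that tail. The two cases of
  the statement merge, since the residual life at time 0 is simply the first gap.\<close>

lemma Gamma_real_ge_powr:
  fixes a R :: real
  assumes "a \<ge> 1" "R > 0"
  shows "Gamma a \<ge> R powr (a - 1) * exp (- (R + 1))"
proof -
  have int: "(\<lambda>t::real. t powr (a - 1) / exp t) integrable_on {0..}"
    using assms by (auto intro!: Gamma_integral_real[THEN has_integral_integrable])
  have int': "(\<lambda>t::real. t powr (a - 1) / exp t) integrable_on {R..R+1}"
    by (rule integrable_on_subinterval[OF int]) (use assms in auto)
  \<comment> \<open>Only the window from \<open>R\<close> to \<open>R + 1\<close> of Euler's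
    integral is kept. Since \<open>R\<close> is free, this yields growth faster than any prescribed
    geometric rate.\<close>
  have "integral {R..R+1} (\<lambda>_. R powr (a - 1) * exp (- (R + 1))) \<le> integral {R..R+1} (\<lambda>t. t powr (a - 1) / exp t)"
  proof (rule integral_le)
    fix t assume t: "t \<in> {R..R+1}"
    have "R powr (a - 1) * exp (- (R + 1)) \<le> t powr (a - 1) * exp (- t)"
      using assms t by (intro mult_mono powr_mono2) auto
    then show "R powr (a - 1) * exp (- (R + 1)) \<le> t powr (a - 1) / exp t"
      by (simp add: exp_minus field_simps)
  qed (use int' in auto)
  also have "\<dots> \<le> integral {0..} (\<lambda>t. t powr (a - 1) / exp t)"
    by (rule integral_subset_le) (use int int' assms in auto)
  also have "integral {0..} (\<lambda>t. t powr (a - 1) / exp t) = Gamma a"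
    using assms by (intro integral_unique Gamma_integral_real) auto
  finally show ?thesis using assms by simp
qed

text \<open>Gamma outgrows every geometric sequence. With \<open>b\<close> free, this dominates both
  the Mittag-Leffler series and the alternating series of \<open>ml_density\<close>.\<close>

lemma summable_power_div_Gamma:
  fixes \<beta> b C :: real
  assumes "\<beta> > 0" "C \<ge> 0"
  shows "summable (\<lambda>k. C ^ k / Gamma (\<beta> * real k + b))"
proof -
  \<comment> \<open>Chosen such that R^\<beta> = 2 C + 1, which is positive even for
    \<open>C = 0\<close> and makes the ratio of the majorant C / (2 C + 1) \<le> 1/2.\<close>
  define R where "R = (2 * C + 1) powr (1 / \<beta>)"
  have R: "R > 0" and Rb: "R powr \<beta> = 2 * C + 1"
    using assms by (auto simp: R_def powr_powr)
  define D where "D = exp (R + 1) * R powr (1 - b)"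
  \<comment> \<open>As \<open>b\<close> may be negative, the argument of Gamma enters the range of
    the lower bound only for large \<open>k\<close>.\<close>
  have "eventually (\<lambda>k. real k \<ge> (1 - b) / \<beta>) sequentially"
    using filterlim_real_sequentially by (simp add: filterlim_at_top)
  then have "eventually (\<lambda>k. \<beta> * real k + b \<ge> 1) sequentially"
    by eventually_elim (use assms in \<open>simp add: field_simps\<close>)
  then have "eventually (\<lambda>k. norm (C ^ k / Gamma (\<beta> * real k + b)) \<le> D * (1/2) ^ k) sequentially"
  proof eventually_elim
    case (elim k)
    have "Gamma (\<beta> * real k + b) \<ge> R powr (\<beta> * real k + b - 1) * exp (- (R + 1))"
      using Gamma_real_ge_powr[OF elim R] by simp
    also have "R powr (\<beta> * real k + b - 1) * exp (- (R + 1)) = (2 * C + 1) ^ k / D"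
    proof -
      have "R powr (\<beta> * real k + b - 1) = (R powr \<beta>) powr real k * R powr (b - 1)"
        by (simp add: powr_powr flip: powr_add) (simp add: algebra_simps)
      also have "(R powr \<beta>) powr real k = (2 * C + 1) ^ k"
        using Rb assms by (simp add: powr_realpow)
      also have "R powr (b - 1) = 1 / R powr (1 - b)"
        using R powr_minus_divide[of R "1 - b"] by simp
      finally show ?thesis by (simp add: D_def exp_minus exp_diff exp_add field_simps)
    qed
    finally have G: "(2 * C + 1) ^ k / D \<le> Gamma (\<beta> * real k + b)" .
    have D: "D > 0" using R by (simp add: D_def)
    have pos: "(2 * C + 1) ^ k / D > 0" using assms D by simp
    have "norm (C ^ k / Gamma (\<beta> * real k + b)) = C ^ k / Gamma (\<beta> * real k + b)"
      using assms G pos by (simp add: abs_of_nonneg)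
    also have "\<dots> \<le> C ^ k / ((2 * C + 1) ^ k / D)"
      using assms G pos by (intro divide_left_mono mult_pos_pos less_le_trans[OF pos G]) auto
    also have "\<dots> = D * (C / (2 * C + 1)) ^ k" by (simp add: power_divide)
    also have "\<dots> \<le> D * (1 / 2) ^ k"
      using D assms by (intro mult_left_mono power_mono) (auto simp: field_simps)
    finally show ?case .
  qed
  then show ?thesis
    by (rule summable_comparison_test_ev) (intro summable_mult summable_geometric, simp)
qed

text \<open>The kernel of the Riemann-Liouville integral of order \<open>a\<close>, extended by \<open>0\<close> to the left of the
  origin so that convolutions run over the whole line.\<close>

definition rl_kernel :: "real \<Rightarrow> real \<Rightarrow> real" where
  "rl_kernel a x = (if x > 0 then x powr (a - 1) / Gamma a else 0)"

lemma borel_measurable_rl_kernel [measurable]: "rl_kernel a \<in> borel_measurable borel"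
  unfolding rl_kernel_def by measurable

lemma rl_kernel_nonneg: "a > 0 \<Longrightarrow> rl_kernel a x \<ge> 0"
  by (simp add: rl_kernel_def)

text \<open>The substitution y = x t turns the convolution into the Beta integral. Stating it with
  \<open>has_bochner_integral\<close> carries integrability along with the value.\<close>

lemma rl_kernel_convolution:
  assumes a: "a > 0" and b: "b > 0"
  shows "has_bochner_integral lborel (\<lambda>y. rl_kernel a (x - y) * rl_kernel b y) (rl_kernel (a + b) x)"
proof (cases "x > 0")
  case False
  then have "(\<lambda>y. rl_kernel a (x - y) * rl_kernel b y) = (\<lambda>_. 0)"
    by (auto simp: rl_kernel_def)
  moreover have "rl_kernel (a + b) x = 0"
    using False by (simp add: rl_kernel_def)
  ultimately show ?thesis
    by (simp add: has_bochner_integral_zero)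
next
  case x: True
  let ?B = "\<lambda>t::real. t powr (b - 1) * (1 - t) powr (a - 1)"
  \<comment> \<open>\<open>0 powr r\<close> is 0, so the endpoints contribute nothing and the
    integrands agree at every point.\<close>
  have *: "indicat_real {0..1} t *\<^sub>R ?B t = indicat_real {0<..<1} t *\<^sub>R ?B t" for t :: real
    by (auto simp: indicator_def)
  have "has_bochner_integral lborel (\<lambda>t. indicat_real {0..1} t *\<^sub>R ?B t) (Beta b a)"
  proof -
    have "set_integrable lborel {0..1} ?B"
      by (rule integrable_Beta) fact+
    moreover from this have "(LBINT t:{0..1}. ?B t) = Beta b a"
      using set_borel_integral_eq_integral(2)[of "{0..1}" ?B]
        integral_unique[OF has_integral_Beta_real[OF b a]] by simp
    ultimately show ?thesis
      by (simp add: set_integrable_def set_lebesgue_integral_def has_bochner_integral_iff)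
  qed
  from has_bochner_integral_mult_right[OF this, of "x powr (a + b - 2) / (Gamma a * Gamma b)"]
  have "has_bochner_integral lborel (\<lambda>t. rl_kernel a (x - (0 + x * t)) * rl_kernel b (0 + x * t))
          (x powr (a + b - 2) / (Gamma a * Gamma b) * Beta b a)"
  proof (rule has_bochner_integral_cong[THEN iffD1, rotated -1])
    fix t :: real
    have "x powr (a + b - 2) = x powr (a - 1) * x powr (b - 1)"
      by (simp flip: powr_add)
    moreover have "x - x * t = x * (1 - t)" by (simp add: algebra_simps)
    ultimately show "x powr (a + b - 2) / (Gamma a * Gamma b) * (indicat_real {0..1} t *\<^sub>R ?B t) =
            rl_kernel a (x - (0 + x * t)) * rl_kernel b (0 + x * t)"
      unfolding * using x by (auto simp: rl_kernel_def indicator_def zero_less_mult_iff powr_mult)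
  qed auto
  also have "x powr (a + b - 2) / (Gamma a * Gamma b) * Beta b a = rl_kernel (a + b) x /\<^sub>R \<bar>x\<bar>"
  proof -
    have "x powr (a + b - 1) = x powr (a + b - 2) * x"
      using x powr_add[of x "a + b - 2" 1] by simp
    then show ?thesis
      using x a b by (simp add: rl_kernel_def Beta_def field_simps Gamma_eq_zero_iff)
        (auto simp: Gamma_real_pos less_imp_neq[symmetric] add_ac)
  qed
  finally show ?thesis
    using x by (subst lborel_has_bochner_integral_real_affine_iff[of x _ _ 0]) auto
qed

text \<open>Writing \<open>u\<close> for \<^const>\<open>rl_kernel\<close> \<open>\<beta>\<close> and products for convolutions, this is
  \<open>(\<mu> u / (1 + \<mu> u)) ^ Suc m\<close>, expanded by the binomial series.\<close>

definition ml_density :: "real \<Rightarrow> real \<Rightarrow> nat \<Rightarrow> real \<Rightarrow> real" where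
  "ml_density \<beta> \<mu> m x =
     (\<Sum>k. (-1) ^ k * real (m + k choose k) * \<mu> ^ (Suc m + k) * rl_kernel (\<beta> * real (Suc m + k)) x)"

lemma borel_measurable_ml_density [measurable]: "ml_density \<beta> \<mu> m \<in> borel_measurable borel"
  unfolding ml_density_def by measurable

lemma ml_density_nonpos: "x \<le> 0 \<Longrightarrow> ml_density \<beta> \<mu> m x = 0"
  by (simp add: ml_density_def rl_kernel_def)

lemma summable_ml_density_majorant:
  assumes "\<beta> > 0" "\<mu> > 0"
  shows "summable (\<lambda>k. real (m + k choose k) * \<mu> ^ (Suc m + k) * rl_kernel (\<beta> * real (Suc m + k)) x)"
proof (cases "x > 0")
  case False
  then show ?thesis by (simp add: rl_kernel_def)
next
  case x: True
  \<comment> \<open>The factor 2 here and the factor 2^m in \<open>D\<close> absorb the bound 2^(m +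
    k) for the binomial coefficient.\<close>
  define C where "C = 2 * \<mu> * x powr \<beta>"
  define D where "D = 2 ^ m * \<mu> ^ Suc m * x powr (\<beta> * Suc m - 1)"
  have "summable (\<lambda>k. D * (C ^ k / Gamma (\<beta> * real k + \<beta> * Suc m)))"
    using assms x by (intro summable_mult summable_power_div_Gamma) (auto simp: C_def)
  then show ?thesis
  proof (rule summable_comparison_test')
    fix k :: nat
    have pos: "Gamma (\<beta> * real (Suc m + k)) > 0"
      using assms by (intro Gamma_real_pos) auto
    have "real (m + k choose k) \<le> 2 ^ (m + k)"
      using binomial_le_pow2[of "m + k" k] by (metis of_nat_le_iff of_nat_numeral of_nat_power)
    then have "real (m + k choose k) * \<mu> ^ (Suc m + k) * rl_kernel (\<beta> * real (Suc m + k)) x \<le>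
        2 ^ (m + k) * \<mu> ^ (Suc m + k) * rl_kernel (\<beta> * real (Suc m + k)) x"
      using assms by (intro mult_right_mono rl_kernel_nonneg) auto
    also have "\<dots> = D * (C ^ k / Gamma (\<beta> * real k + \<beta> * Suc m))"
    proof -
      have "x powr (\<beta> * real (Suc m + k) - 1) = x powr (\<beta> * Suc m - 1) * (x powr \<beta>) powr real k"
        by (simp add: powr_powr flip: powr_add) (simp add: algebra_simps)
      also have "(x powr \<beta>) powr real k = (x powr \<beta>) ^ k"
        using x by (simp add: powr_realpow)
      finally show ?thesis
        using x by (simp add: rl_kernel_def C_def D_def power_mult_distrib power_add field_simps)
    qed
    finally show "norm (real (m + k choose k) * \<mu> ^ (Suc m + k) * rl_kernel (\<beta> * real (Suc m + k)) x) \<le>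
        D * (C ^ k / Gamma (\<beta> * real k + \<beta> * Suc m))"
      using assms rl_kernel_nonneg[of "\<beta> * real (Suc m + k)" x]
      by (simp add: abs_mult)
  qed
qed

lemma summable_ml_density_norm:
  assumes "\<beta> > 0" "\<mu> > 0"
  shows "summable (\<lambda>k. norm ((-1) ^ k * real (m + k choose k) * \<mu> ^ (Suc m + k) *
      rl_kernel (\<beta> * real (Suc m + k)) x))"
proof -
  have "norm ((-1) ^ k * real (m + k choose k) * \<mu> ^ (Suc m + k) * rl_kernel (\<beta> * real (Suc m + k)) x) =
      real (m + k choose k) * \<mu> ^ (Suc m + k) * rl_kernel (\<beta> * real (Suc m + k)) x" for k
    using assms rl_kernel_nonneg[of "\<beta> * real (Suc m + k)" x] by (simp add: abs_mult)
  then show ?thesis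
    using summable_ml_density_majorant[OF assms] by simp
qed

text \<open>The Cauchy product is integrated diagonal by diagonal. All terms of diagonal
  \<open>l\<close> have the same order \<beta> (m + 2 + l), and their coefficients add up to one
  binomial coefficient by the hockey-stick identity. They also share the sign (-1)^l, so nothing
  cancels within a diagonal: its L1 norm is bounded by the absolute value of its integral
  \<open>g l\<close>, and summability of these values justifies exchanging sum and integral.\<close>

lemma ml_density_convolution:
  assumes \<beta>: "\<beta> > 0" and \<mu>: "\<mu> > 0"
  shows "has_bochner_integral lborel (\<lambda>y. ml_density \<beta> \<mu> m (x - y) * ml_density \<beta> \<mu> 0 y)
           (ml_density \<beta> \<mu> (Suc m) x)"
proof -
  define u where "u m k y = (-1) ^ k * real (m + k choose k) * \<mu> ^ (Suc m + k) *
    rl_kernel (\<beta> * real (Suc m + k)) y" for m k y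
  define f where "f l y = (\<Sum>k\<le>l. u m k (x - y) * u 0 (l - k) y)" for l y
  have u_sum: "summable (\<lambda>k. norm (u m k y))" for m y
    unfolding u_def by (rule summable_ml_density_norm) fact+
  have u_int: "has_bochner_integral lborel (\<lambda>y. u m k (x - y) * u 0 (l - k) y)
      ((-1) ^ l * real (m + k choose k) * \<mu> ^ (Suc (Suc m) + l) * rl_kernel (\<beta> * real (Suc (Suc m) + l)) x)"
    if "k \<le> l" for k l
  proof -
    have eq: "\<beta> * real (Suc m + k) + \<beta> * real (Suc (l - k)) = \<beta> * real (Suc (Suc m) + l)"
      using that by (simp add: of_nat_diff algebra_simps)
    have sgn: "(-1) ^ k * (-1) ^ (l - k) = ((-1) ^ l :: real)" "\<mu> ^ (Suc m + k) * \<mu> ^ Suc (l - k) = \<mu> ^ (Suc (Suc m) + l)"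
      using that by (simp_all flip: power_add)
    have "has_bochner_integral lborel (\<lambda>y. rl_kernel (\<beta> * real (Suc m + k)) (x - y) * rl_kernel (\<beta> * real (Suc (l - k))) y)
       (rl_kernel (\<beta> * real (Suc (Suc m) + l)) x)"
      unfolding eq[symmetric] using \<beta> by (intro rl_kernel_convolution mult_pos_pos) auto
    from has_bochner_integral_mult_right[OF this, of
        "(-1) ^ l * real (m + k choose k) * \<mu> ^ (Suc (Suc m) + l)"]
    show ?thesis
      unfolding u_def sgn[symmetric] by (simp add: mult_ac)
  qed
  define g where "g l = (-1) ^ l * real (Suc m + l choose l) * \<mu> ^ (Suc (Suc m) + l) *
    rl_kernel (\<beta> * real (Suc (Suc m) + l)) x" for l
  have f_int: "has_bochner_integral lborel (f l) (g l)" for l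
  proof -
    have "has_bochner_integral lborel (f l) (\<Sum>k\<le>l. (-1) ^ l * real (m + k choose k) *
        \<mu> ^ (Suc (Suc m) + l) * rl_kernel (\<beta> * real (Suc (Suc m) + l)) x)"
      unfolding f_def by (intro has_bochner_integral_sum u_int) auto
    also have "(\<Sum>k\<le>l. (-1) ^ l * real (m + k choose k) *
        \<mu> ^ (Suc (Suc m) + l) * rl_kernel (\<beta> * real (Suc (Suc m) + l)) x) =
       (-1) ^ l * real (\<Sum>k\<le>l. m + k choose k) *
        \<mu> ^ (Suc (Suc m) + l) * rl_kernel (\<beta> * real (Suc (Suc m) + l)) x"
      by (simp add: sum_distrib_left sum_distrib_right mult_ac)
    finally show ?thesis
      unfolding sum_choose_lower g_def by simp
  qed
  have norm_f: "(\<integral>y. norm (f l y) \<partial>lborel) \<le> norm (g l)" for l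
  proof -
    have u_norm: "norm (u m k y) = (-1) ^ k * u m k y" for m k y
    proof -
      define c where "c = real (m + k choose k) * \<mu> ^ (Suc m + k) * rl_kernel (\<beta> * real (Suc m + k)) y"
      have "c \<ge> 0"
        using \<beta> \<mu> unfolding c_def by (intro mult_nonneg_nonneg rl_kernel_nonneg) auto
      moreover have "u m k y = (-1) ^ k * c" by (simp add: u_def c_def)
      ultimately show ?thesis by (cases "even k") auto
    qed
    have u_sgn: "norm (u m k (x - y) * u 0 (l - k) y) = (-1) ^ l * (u m k (x - y) * u 0 (l - k) y)"
      if "k \<le> l" for k y
    proof -
      have sgn: "(-1) ^ l = (-1) ^ k * ((-1) ^ (l - k) :: real)"
        using that by (simp flip: power_add)
      show ?thesis unfolding norm_mult u_norm sgn by (simp only: mult_ac)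
    qed
    have "(\<integral>y. norm (f l y) \<partial>lborel) \<le> (\<integral>y. (-1) ^ l * f l y \<partial>lborel)"
    proof (rule integral_mono)
      fix y
      have "norm (f l y) \<le> (\<Sum>k\<le>l. norm (u m k (x - y) * u 0 (l - k) y))"
        unfolding f_def by (rule norm_sum)
      also have "\<dots> = (-1) ^ l * f l y"
        unfolding f_def sum_distrib_left by (intro sum.cong u_sgn) auto
      finally show "norm (f l y) \<le> (-1) ^ l * f l y" .
    qed (use f_int[of l] in \<open>auto simp: has_bochner_integral_iff\<close>)
    also have "\<dots> = (-1) ^ l * g l"
      using f_int[of l] by (simp add: has_bochner_integral_iff)
    also have "\<dots> \<le> norm (g l)"
      by (cases "even l") auto
    finally show ?thesis .
  qed
  have f_i: "integrable lborel (f l)" for l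
    using f_int[of l] by (simp add: has_bochner_integral_iff)
  have f_abs: "summable (\<lambda>l. norm (f l y))" for y
  proof (rule summable_comparison_test')
    show "summable (\<lambda>l. \<Sum>k\<le>l. norm (u m k (x - y)) * norm (u 0 (l - k) y))"
      using Cauchy_product_sums[of "\<lambda>k. norm (u m k (x - y))" "\<lambda>k. norm (u 0 k y)"] u_sum
      by (auto intro: sums_summable)
    show "norm (norm (f l y)) \<le> (\<Sum>k\<le>l. norm (u m k (x - y)) * norm (u 0 (l - k) y))" for l
      unfolding real_norm_def abs_idempotent f_def by (rule order_trans[OF sum_abs]) (simp only: abs_mult order_refl)
  qed
  have "summable (\<lambda>l. norm (g l))"
    unfolding g_def by (rule summable_ml_density_norm) fact+
  then have f_norm: "summable (\<lambda>l. \<integral>y. norm (f l y) \<partial>lborel)"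
    by (rule summable_comparison_test') (use norm_f in auto)
  have "ml_density \<beta> \<mu> m (x - y) * ml_density \<beta> \<mu> 0 y = (\<Sum>l. f l y)" for y
    using Cauchy_product[OF u_sum u_sum, of m "x - y" 0 y]
    by (simp add: ml_density_def u_def f_def)
  moreover have "ml_density \<beta> \<mu> (Suc m) x = (\<Sum>l. g l)"
    by (simp add: ml_density_def g_def)
  moreover have "has_bochner_integral lborel (\<lambda>y. \<Sum>l. f l y) (\<Sum>l. g l)"
    using integrable_suminf[OF f_i AE_I2[OF f_abs] f_norm] integral_suminf[OF f_i AE_I2[OF f_abs] f_norm] f_int
    by (simp add: has_bochner_integral_iff)
  ultimately show ?thesis by simp
qed

text \<open>Makes each integrand of \<open>F_LJ\<close> a convolution density, term by term. With n
  = m + 1 and b = \<beta> (n + k), the equation Gamma (b + 1) = b Gamma b leaves \<beta> n (n + k)!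
  / (n! k! b), which is the binomial coefficient of m + k over k. This explains the prefactor
  \<beta> n.\<close>

lemma prabhakar_eq_ml_density:
  assumes \<beta>: "\<beta> > 0" and \<mu>: "\<mu> > 0" and x: "x \<ge> 0"
  shows "\<beta> * real (Suc m) * \<mu> ^ Suc m * (x powr (real (Suc m) * \<beta> - 1) *
           prabhakar \<beta> (real (Suc m) * \<beta> + 1) (real (Suc m) + 1) (- \<mu> * x powr \<beta>)) = ml_density \<beta> \<mu> m x"
proof (cases "x = 0")
  \<comment> \<open>Both sides vanish at 0 by the convention \<open>0 powr r = 0\<close>, even where
    the exponent is negative.\<close>
  case True
  then show ?thesis by (simp add: ml_density_nonpos)
next
  case False
  with x have x: "x > 0" by simp
  define P where "P = \<beta> * real (Suc m) * \<mu> ^ Suc m * x powr (real (Suc m) * \<beta> - 1)"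
  define p where "p k = Gamma (real (Suc m) + 1 + real k) * (- \<mu> * x powr \<beta>) ^ k /
     (Gamma (real (Suc m) + 1) * fact k * Gamma (\<beta> * real k + (real (Suc m) * \<beta> + 1)))" for k
  define q where "q k = (-1) ^ k * real (m + k choose k) * \<mu> ^ (Suc m + k) * rl_kernel (\<beta> * real (Suc m + k)) x" for k
  have "P > 0" using \<beta> \<mu> x by (simp add: P_def)
  have eq: "P * p k = q k" for k
  proof -
    define b where "b = \<beta> * real (Suc m + k)"
    have b: "b > 0" using \<beta> by (simp add: b_def)
    have "real (fact (m + k)) = real (m + k choose k) * (fact k * fact m)"
      using arg_cong[OF binomial_fact_lemma[of k "m + k"], of real] by (simp add: mult_ac)
    then have f: "fact (Suc m + k) = real (Suc m + k) * (real (m + k choose k) * (fact k * fact m))"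
      by simp
    have "real (Suc m) + 1 + real k = 1 + real (Suc m + k)" by simp
    then have 1: "Gamma (real (Suc m) + 1 + real k) =
      real (Suc m + k) * (real (m + k choose k) * (fact k * fact m))"
      using f by (simp only: Gamma_fact)
    have 2: "Gamma (real (Suc m) + 1) = real (Suc m) * fact m"
      using Gamma_fact[of "Suc m", where 'a=real] by (simp add: add.commute)
    have "\<beta> * real k + (real (Suc m) * \<beta> + 1) = b + 1" by (simp add: b_def algebra_simps)
    moreover have "Gamma (b + 1) = b * Gamma b"
      by (intro Gamma_plus1) (use b in \<open>auto dest: nonpos_Ints_nonpos\<close>)
    ultimately have 3: "Gamma (\<beta> * real k + (real (Suc m) * \<beta> + 1)) = b * Gamma b" by (simp only:)
    have "x powr (b - 1) = x powr (real (Suc m) * \<beta> - 1) * (x powr \<beta>) powr real k"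
      by (simp add: b_def powr_powr flip: powr_add) (simp add: algebra_simps)
    also have "(x powr \<beta>) powr real k = (x powr \<beta>) ^ k"
      using x by (simp add: powr_realpow)
    finally have 4: "x powr (b - 1) = x powr (real (Suc m) * \<beta> - 1) * (x powr \<beta>) ^ k" .
    have q: "q k = (-1) ^ k * real (m + k choose k) * \<mu> ^ (Suc m + k) *
        (x powr (real (Suc m) * \<beta> - 1) * (x powr \<beta>) ^ k) / Gamma b"
      using x unfolding q_def rl_kernel_def 4[symmetric] b_def[symmetric] by simp
    have G: "Gamma b > 0" using b by (rule Gamma_real_pos)
    have "(- \<mu> * x powr \<beta>) ^ k = (-1) ^ k * \<mu> ^ k * (x powr \<beta>) ^ k"
      unfolding power_mult_distrib[symmetric] by simp
    then have "P * p k = \<beta> * real (Suc m + k) * (real (Suc m) * fact m * fact k) *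
        ((-1) ^ k * real (m + k choose k) * \<mu> ^ (Suc m + k) *
        (x powr (real (Suc m) * \<beta> - 1) * (x powr \<beta>) ^ k)) / (b * (real (Suc m) * fact m * fact k) * Gamma b)"
      unfolding p_def P_def 1 2 3 by (simp only: power_add mult_ac times_divide_eq_left times_divide_eq_right)
    also have "\<dots> = q k"
      using b G unfolding q b_def[symmetric] by (simp del: of_nat_Suc of_nat_add)
    finally show ?thesis .
  qed
  have "summable q"
    using summable_ml_density_norm[OF \<beta> \<mu>, of m x] unfolding q_def by (rule summable_norm_cancel)
  then have "summable (\<lambda>k. P * p k)" by (simp add: eq)
  then have "summable p" using \<open>P > 0\<close> by (simp add: summable_cmult_iff)
  then have "P * (\<Sum>k. p k) = (\<Sum>k. q k)" using suminf_mult[of p P] by (simp add: eq)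
  then show ?thesis
    unfolding prabhakar_def ml_density_def p_def q_def P_def by (simp only: mult.assoc)
qed

section \<open>The Mittag-Leffler function and the slope of its tail\<close>

lemma summable_mittag_leffler:
  assumes "\<beta> > 0"
  shows "summable (\<lambda>k. 1 / Gamma (\<beta> * real k + 1) * x ^ k)"
proof (rule summable_norm_cancel)
  have "norm (1 / Gamma (\<beta> * real k + 1) * x ^ k) = \<bar>x\<bar> ^ k / Gamma (\<beta> * real k + 1)" for k
    using Gamma_real_pos[of "\<beta> * real k + 1"] assms by (simp add: abs_mult power_abs add_nonneg_pos)
  then show "summable (\<lambda>k. norm (1 / Gamma (\<beta> * real k + 1) * x ^ k))"
    using summable_power_div_Gamma[OF assms, of "\<bar>x\<bar>" 1] by simp
qed

lemma mittag_leffler_has_derivative: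
  assumes "\<beta> > 0"
  shows "(mittag_leffler \<beta> has_real_derivative (\<Sum>k. diffs (\<lambda>k. 1 / Gamma (\<beta> * real k + 1)) k * x ^ k)) (at x)"
proof -
  have "mittag_leffler \<beta> = (\<lambda>x. \<Sum>k. 1 / Gamma (\<beta> * real k + 1) * x ^ k)"
    by (simp add: mittag_leffler_def fun_eq_iff)
  then show ?thesis
    using termdiffs_strong_converges_everywhere[OF summable_mittag_leffler[OF assms]] by simp
qed

lemma mittag_leffler_0: "mittag_leffler \<beta> 0 = 1"
proof -
  have "(\<lambda>k. 0 ^ k / Gamma (\<beta> * real k + 1)) sums (0 ^ 0 / Gamma (\<beta> * real 0 + 1))"
    using sums_finite[of "{0}" "\<lambda>k. 0 ^ k / Gamma (\<beta> * real k + 1)"] by simp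
  then show ?thesis by (simp add: mittag_leffler_def sums_iff)
qed

text \<open>Identifies the series with \<open>m = 0\<close> as the density belonging to the tail. It
  is confined to x > 0 because \<open>x powr \<beta>\<close> has infinite slope at 0 when \<beta> <
  1.\<close>

lemma ml_tail_has_derivative:
  assumes \<beta>: "\<beta> > 0" and \<mu>: "\<mu> > 0" and x: "x > 0"
  shows "((\<lambda>x. mittag_leffler \<beta> (- \<mu> * x powr \<beta>)) has_real_derivative - ml_density \<beta> \<mu> 0 x) (at x)"
proof -
  let ?c = "\<lambda>k. 1 / Gamma (\<beta> * real k + 1)"
  let ?y = "- \<mu> * x powr \<beta>"
  define D where "D = - \<mu> * (\<beta> * x powr (\<beta> - 1))"
  have "((\<lambda>x. - \<mu> * x powr \<beta>) has_real_derivative D) (at x)"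
    unfolding D_def using x by (auto intro!: derivative_eq_intros)
  then have "((\<lambda>x. mittag_leffler \<beta> (- \<mu> * x powr \<beta>)) has_real_derivative (\<Sum>k. diffs ?c k * ?y ^ k) * D) (at x)"
    by (rule DERIV_chain2[OF mittag_leffler_has_derivative[OF \<beta>]])
  moreover have "(\<Sum>k. diffs ?c k * ?y ^ k) * D = - ml_density \<beta> \<mu> 0 x"
  proof -
    have "diffs ?c k * ?y ^ k * D = - ((-1) ^ k * real (0 + k choose k) * \<mu> ^ (Suc 0 + k) * rl_kernel (\<beta> * real (Suc 0 + k)) x)" for k
    proof -
      define b where "b = \<beta> * real (Suc k)"
      have b: "b > 0" using \<beta> by (simp add: b_def)
      have "Gamma (b + 1) = b * Gamma b"
        by (intro Gamma_plus1) (use b in \<open>auto dest: nonpos_Ints_nonpos\<close>)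
      then have "diffs ?c k = 1 / (\<beta> * Gamma b)"
        using b \<beta> unfolding diffs_def b_def[symmetric] by (simp add: b_def del: of_nat_Suc)
      moreover have "?y ^ k = (-1) ^ k * \<mu> ^ k * (x powr \<beta>) ^ k"
        unfolding power_mult_distrib[symmetric] by simp
      moreover have "(x powr \<beta>) ^ k * x powr (\<beta> - 1) = x powr (b - 1)"
      proof -
        have "(x powr \<beta>) ^ k = (x powr \<beta>) powr real k"
          using x by (simp add: powr_realpow)
        also have "\<dots> * x powr (\<beta> - 1) = x powr (b - 1)"
          unfolding powr_powr powr_add[symmetric] by (simp add: b_def algebra_simps)
        finally show ?thesis .
      qed
      ultimately show ?thesis
        using x \<beta> by (simp add: rl_kernel_def D_def field_simps flip: b_def) (simp add: b_def algebra_simps)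
    qed
    moreover have "summable (\<lambda>k. diffs ?c k * ?y ^ k)"
      by (rule termdiff_converges_all[OF summable_mittag_leffler[OF \<beta>]])
    moreover have "summable (\<lambda>k. (-1) ^ k * real (0 + k choose k) * \<mu> ^ (Suc 0 + k) * rl_kernel (\<beta> * real (Suc 0 + k)) x)"
      using summable_ml_density_norm[OF \<beta> \<mu>, of 0 x] by (rule summable_norm_cancel)
    ultimately show ?thesis
      by (simp only: suminf_mult2 ml_density_def suminf_minus)
  qed
  ultimately show ?thesis by simp
qed

section \<open>Renewal processes with Mittag-Leffler gaps\<close>

text \<open>The origin counts as epoch 0, so that a time before the first renewal still has a last
  epoch. This is the source of the atom of \<open>F_LJ\<close> at 0.\<close>

definition epoch :: "(nat \<Rightarrow> real) \<Rightarrow> nat \<Rightarrow> real" where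
  "epoch z j = (\<Sum>i<j. z i)"

lemma epoch_0 [simp]: "epoch z 0 = 0"
  and epoch_Suc: "epoch z (Suc j) = epoch z j + z j"
  by (simp_all add: epoch_def)

lemma epoch_cong: "(\<And>i. i < j \<Longrightarrow> z i = z' i) \<Longrightarrow> epoch z j = epoch z' j"
  by (simp add: epoch_def)

text \<open>The renewal property at the level of sequences: replacing the gaps from index
  \<open>k\<close> on restarts the epochs from epoch \<open>k\<close>.\<close>

lemma epoch_comb_seq: "epoch (comb_seq k z z') (k + j) = epoch z k + epoch z' j"
proof (induction j)
  case 0
  show ?case by (auto intro!: epoch_cong simp: comb_seq_less)
next
  case (Suc j)
  have "comb_seq k z z' (k + j) = z' j" by (simp add: comb_seq_def)
  with Suc show ?case by (simp add: epoch_Suc)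
qed

lemma strict_mono_epoch:
  assumes "\<And>i. z i > 0"
  shows "strict_mono (epoch z)"
  unfolding strict_mono_Suc_iff using assms by (simp add: epoch_Suc)

lemma measurable_epoch [measurable (raw)]:
  assumes [measurable]: "f \<in> measurable N (\<Pi>\<^sub>M i\<in>(UNIV :: nat set). borel)"
  shows "(\<lambda>x. epoch (f x) j) \<in> borel_measurable N"
  unfolding epoch_def by measurable

text \<open>The law is given as a probability measure, so that monotonicity and decay of the
  Mittag-Leffler tail are facts about measures of half-lines.\<close>

locale ml_renewal = law: prob_space \<nu> for \<nu> :: "real measure" +
  fixes \<beta> \<mu> :: real
  assumes sets_law [measurable_cong]: "sets \<nu> = sets borel"
    and \<beta>_pos: "\<beta> > 0" and \<mu>_pos: "\<mu> > 0"
    and measure_greaterThan: "t \<ge> 0 \<Longrightarrow> measure \<nu> {t<..} = mittag_leffler \<beta> (- \<mu> * t powr \<beta>)"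

text \<open>From here on \<open>S\<close> is the law of an i.i.d. sequence of gaps.\<close>

sublocale ml_renewal \<subseteq> sequence_space \<nu>
  by unfold_locales

context ml_renewal
begin

section \<open>The law of a single gap and of the epochs\<close>

definition tail :: "real \<Rightarrow> real" where
  "tail t = mittag_leffler \<beta> (- \<mu> * t powr \<beta>)"

lemma emeasure_greaterThan: "t \<ge> 0 \<Longrightarrow> emeasure \<nu> {t<..} = ennreal (tail t)"
  using measure_greaterThan by (simp add: law.emeasure_eq_measure tail_def)

lemma tail_nonneg: "t \<ge> 0 \<Longrightarrow> tail t \<ge> 0"
  using measure_greaterThan[of t] measure_nonneg[of \<nu> "{t<..}"] by (simp add: tail_def)

lemma tail_antimono: "0 \<le> s \<Longrightarrow> s \<le> t \<Longrightarrow> tail t \<le> tail s"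
  unfolding tail_def using measure_greaterThan[of s] measure_greaterThan[of t]
    law.finite_measure_mono[of "{t<..}" "{s<..}"] by (simp add: sets_law)

lemma tail_0: "tail 0 = 1"
  using \<beta>_pos by (simp add: tail_def mittag_leffler_0)

lemma borel_measurable_tail [measurable]: "tail \<in> borel_measurable borel"
proof -
  have [measurable]: "mittag_leffler \<beta> \<in> borel_measurable borel"
    using mittag_leffler_has_derivative[OF \<beta>_pos]
    by (intro borel_measurable_continuous_onI) (auto intro!: continuous_at_imp_continuous_on DERIV_isCont)
  show ?thesis unfolding tail_def by measurable
qed

lemma tail_tendsto_0: "(tail \<longlongrightarrow> 0) at_top"
proof -
  interpret real_distribution \<nu>
    by unfold_locales (simp_all add: sets_law sets_eq_imp_space_eq[OF sets_law])
  have "((\<lambda>t. 1 - cdf \<nu> t) \<longlongrightarrow> 1 - 1) at_top"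
    by (intro tendsto_intros cdf_lim_at_top_prob)
  moreover have "eventually (\<lambda>t. 1 - cdf \<nu> t = tail t) at_top"
    using eventually_ge_at_top[of 0]
  proof eventually_elim
    case (elim t)
    have "UNIV - {..t} = {t<..}" by auto
    then have "measure \<nu> {t<..} = 1 - measure \<nu> {..t}"
      using law.prob_compl[of "{..t}"] by (simp add: sets_law)
    with elim show ?case by (simp add: measure_greaterThan cdf_def tail_def)
  qed
  ultimately have "(tail \<longlongrightarrow> 1 - 1) at_top"
    by (rule Lim_transform_eventually)
  then show ?thesis by simp
qed

lemma density_0_nonneg: "ml_density \<beta> \<mu> 0 x \<ge> 0"
proof (cases "x > 0")
  case True
  have "mono_on {0..} (\<lambda>x. - tail x)"
    by (auto intro!: mono_onI tail_antimono)
  moreover have "((\<lambda>x. - tail x) has_real_derivative ml_density \<beta> \<mu> 0 x) (at x)"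
    using DERIV_minus[OF ml_tail_has_derivative[OF \<beta>_pos \<mu>_pos True]] by (simp add: tail_def)
  ultimately show ?thesis
    by (rule mono_on_imp_deriv_nonneg) (use True in simp)
qed (simp add: ml_density_nonpos)

text \<open>The series does not show this: for \<open>m = 0\<close> it comes from the monotonicity of \<open>tail\<close>, and
  convolution preserves it.\<close>

lemma density_nonneg: "ml_density \<beta> \<mu> m x \<ge> 0"
proof (induction m arbitrary: x)
  case (Suc m)
  have "0 \<le> (\<integral>y. ml_density \<beta> \<mu> m (x - y) * ml_density \<beta> \<mu> 0 y \<partial>lborel)"
    by (intro integral_nonneg_AE AE_I2 mult_nonneg_nonneg Suc density_0_nonneg)
  also have "\<dots> = ml_density \<beta> \<mu> (Suc m) x"
    using ml_density_convolution[OF \<beta>_pos \<mu>_pos] by (rule has_bochner_integral_integral_eq)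
  finally show ?case .
qed (rule density_0_nonneg)

text \<open>Compares masses of half-lines. The density may be unbounded near 0, so the fundamental
  theorem is applied on [x, \<infinity>) for x > 0 only; the half-line from 0 follows by continuity
  along 1 / (n + 1). As \<open>tail 0\<close> is 1, neither measure has mass at or below 0.\<close>

lemma law_eq_density: "\<nu> = density lborel (\<lambda>x. ennreal (ml_density \<beta> \<mu> 0 x))"
proof (rule measure_eqI_lessThan)
  let ?D = "density lborel (\<lambda>x. ennreal (ml_density \<beta> \<mu> 0 x))"
  have pos: "emeasure ?D {x<..} = emeasure \<nu> {x<..}" if "x > 0" for x
  proof -
    have "emeasure ?D {x<..} = (\<integral>\<^sup>+y. ennreal (ml_density \<beta> \<mu> 0 y) * indicator {x<..} y \<partial>lborel)"
      by (simp add: emeasure_density)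
    also have "\<dots> = (\<integral>\<^sup>+y. ennreal (ml_density \<beta> \<mu> 0 y) * indicator {x..} y \<partial>lborel)"
      using AE_lborel_singleton[of x] by (intro nn_integral_cong_AE) (auto simp: indicator_def)
    also have "\<dots> = ennreal (0 - (- tail x))"
    proof (rule nn_integral_FTC_atLeast)
      fix y assume "x \<le> y"
      with that have "y > 0" by simp
      then show "((\<lambda>x. - tail x) has_real_derivative ml_density \<beta> \<mu> 0 y) (at y)"
        using DERIV_minus[OF ml_tail_has_derivative[OF \<beta>_pos \<mu>_pos]] by (simp add: tail_def)
    next
      show "((\<lambda>x. - tail x) \<longlongrightarrow> 0) at_top"
        using tendsto_minus[OF tail_tendsto_0] by simp
    qed (auto simp: density_0_nonneg)
    finally show ?thesis using that by (simp add: emeasure_greaterThan)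
  qed
  have zero: "emeasure ?D {0<..} = emeasure \<nu> {0<..}"
  proof -
    have un: "(\<Union>n. {1 / real (Suc n)<..}) = {0::real<..}"
    proof (intro set_eqI iffI)
      fix x :: real assume "x \<in> (\<Union>n. {1 / real (Suc n)<..})"
      then obtain n where "1 / real (Suc n) < x" by auto
      moreover have "0 < 1 / real (Suc n)" by simp
      ultimately show "x \<in> {0<..}" unfolding greaterThan_iff by (rule less_trans[rotated])
    next
      fix x :: real assume "x \<in> {0<..}"
      then obtain n where "1 / real (Suc n) < x" using nat_approx_posE by (metis greaterThan_iff)
      then show "x \<in> (\<Union>n. {1 / real (Suc n)<..})" by auto
    qed
    have inc: "incseq (\<lambda>n. {1 / real (Suc n)<..})"
      by (intro incseq_SucI) (auto simp: field_simps intro: less_trans[rotated])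
    have "emeasure ?D {0<..} = (SUP n. emeasure ?D {1 / real (Suc n)<..})"
      unfolding un[symmetric] using inc by (intro SUP_emeasure_incseq[symmetric]) auto
    also have "\<dots> = (SUP n. emeasure \<nu> {1 / real (Suc n)<..})"
      by (intro SUP_cong pos) auto
    also have "\<dots> = emeasure \<nu> {0<..}"
      unfolding un[symmetric] using inc by (intro SUP_emeasure_incseq) (auto simp: sets_law)
    finally show ?thesis .
  qed
  show "emeasure \<nu> {x<..} = emeasure ?D {x<..}" for x
  proof (cases "x > 0")
    case False
    have "emeasure ?D {x<..} = emeasure ?D {0<..}"
      unfolding emeasure_density[OF measurable_compose[OF borel_measurable_ml_density measurable_ennreal]]
      using False by (subst (1 2) emeasure_density) (auto intro!: nn_integral_cong simp: indicator_def ml_density_nonpos)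
    moreover have "emeasure \<nu> {x<..} = emeasure \<nu> {0<..}"
    proof (rule antisym)
      have "emeasure \<nu> {x<..} \<le> 1" by (rule law.emeasure_le_1)
      also have "1 = emeasure \<nu> {0<..}" by (simp add: emeasure_greaterThan tail_0)
      finally show "emeasure \<nu> {x<..} \<le> emeasure \<nu> {0<..}" .
      show "emeasure \<nu> {0<..} \<le> emeasure \<nu> {x<..}"
        using False by (intro emeasure_mono) (auto simp: sets_law)
    qed
    ultimately show ?thesis using zero by simp
  qed (simp add: pos)
qed (simp_all add: sets_law law.emeasure_eq_measure)

text \<open>This form of independence is the one used throughout: the first \<open>k\<close> gaps
  and all later ones may be drawn from two independent sequences.\<close>

lemma nn_integral_comb_seq:
  assumes [measurable]: "h \<in> borel_measurable S"
  shows "(\<integral>\<^sup>+z. h z \<partial>S) = (\<integral>\<^sup>+z. \<integral>\<^sup>+z'. h (comb_seq k z z') \<partial>S \<partial>S)"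
proof -
  have "(\<integral>\<^sup>+z. h z \<partial>S) = (\<integral>\<^sup>+z. h z \<partial>distr (S \<Otimes>\<^sub>M S) S (\<lambda>(z, z'). comb_seq k z z'))"
    by (simp only: PiM_comb_seq)
  also have "\<dots> = (\<integral>\<^sup>+p. h (case p of (z, z') \<Rightarrow> comb_seq k z z') \<partial>(S \<Otimes>\<^sub>M S))"
    by (rule nn_integral_distr) measurable
  also have "\<dots> = (\<integral>\<^sup>+z. \<integral>\<^sup>+z'. h (comb_seq k z z') \<partial>S \<partial>S)"
    by (subst P.nn_integral_fst[symmetric]) (auto simp: case_prod_beta)
  finally show ?thesis .
qed

lemma nn_integral_component:
  assumes [measurable]: "h \<in> borel_measurable borel"
  shows "(\<integral>\<^sup>+z. h (z i) \<partial>S) = (\<integral>\<^sup>+y. h y \<partial>\<nu>)"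
proof -
  have "(\<integral>\<^sup>+y. h y \<partial>\<nu>) = (\<integral>\<^sup>+y. h y \<partial>distr S \<nu> (\<lambda>z. z i))"
    by (subst PiM_component) auto
  then show ?thesis by (subst (asm) nn_integral_distr) auto
qed

text \<open>Epoch \<open>j\<close> involves only gaps with index below \<open>j\<close>, so gap
  \<open>j\<close> can be integrated out separately.\<close>

lemma nn_integral_epoch_step:
  assumes [measurable]: "case_prod g \<in> borel_measurable (borel \<Otimes>\<^sub>M borel)"
  shows "(\<integral>\<^sup>+z. g (epoch z j) (z j) \<partial>S) = (\<integral>\<^sup>+z. \<integral>\<^sup>+y. g (epoch z j) y \<partial>\<nu> \<partial>S)"
proof -
  have "(\<integral>\<^sup>+z. g (epoch z j) (z j) \<partial>S) =
      (\<integral>\<^sup>+z. \<integral>\<^sup>+z'. g (epoch (comb_seq j z z') j) (comb_seq j z z' j) \<partial>S \<partial>S)"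
    by (rule nn_integral_comb_seq) measurable
  also have "\<dots> = (\<integral>\<^sup>+z. \<integral>\<^sup>+z'. g (epoch z j) (z' 0) \<partial>S \<partial>S)"
    using epoch_comb_seq[of j _ _ 0] by (simp add: comb_seq_def)
  also have "\<dots> = (\<integral>\<^sup>+z. \<integral>\<^sup>+y. g (epoch z j) y \<partial>\<nu> \<partial>S)"
    by (intro nn_integral_cong nn_integral_component) measurable
  finally show ?thesis .
qed

lemma distr_epoch_Suc:
  "distr S borel (\<lambda>z. epoch z (Suc m)) = density lborel (\<lambda>x. ennreal (ml_density \<beta> \<mu> m x))"
proof (induction m)
  case 0
  have "distr S borel (\<lambda>z. epoch z (Suc 0)) = distr S \<nu> (\<lambda>z. z 0)"
    by (intro distr_cong) (auto simp: epoch_def sets_law)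
  also have "\<dots> = \<nu>" by (rule PiM_component) auto
  finally show ?case using law_eq_density by simp
next
  case (Suc m)
  let ?L = "distr S borel (\<lambda>z. epoch z (Suc m))"
  have L: "finite_measure ?L"
    by (intro prob_space.finite_measure P.prob_space_distr) measurable
  have "distr S borel (\<lambda>z. epoch z (Suc (Suc m))) = convolution ?L \<nu>"
  proof (rule measure_eqI)
    fix A assume "A \<in> sets (distr S borel (\<lambda>z. epoch z (Suc (Suc m))))"
    then have [measurable]: "A \<in> sets borel" by simp
    have "emeasure (distr S borel (\<lambda>z. epoch z (Suc (Suc m)))) A =
       (\<integral>\<^sup>+x. indicator A x \<partial>distr S borel (\<lambda>z. epoch z (Suc (Suc m))))"
      by simp
    also have "\<dots> = (\<integral>\<^sup>+z. indicator A (epoch z (Suc (Suc m))) \<partial>S)"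
      by (rule nn_integral_distr) measurable
    also have "\<dots> = (\<integral>\<^sup>+z. \<integral>\<^sup>+y. indicator A (epoch z (Suc m) + y) \<partial>\<nu> \<partial>S)"
      unfolding epoch_Suc[of _ "Suc m"] by (rule nn_integral_epoch_step) measurable
    also have "\<dots> = (\<integral>\<^sup>+x. \<integral>\<^sup>+y. indicator A (x + y) \<partial>\<nu> \<partial>?L)"
      by (subst nn_integral_distr) measurable
    also have "\<dots> = emeasure (convolution ?L \<nu>) A"
      using L by (intro convolution_emeasure'[symmetric]) (auto simp: sets_law)
    finally show "emeasure (distr S borel (\<lambda>z. epoch z (Suc (Suc m)))) A = emeasure (convolution ?L \<nu>) A" .
  qed simp
  also have "\<dots> = convolution (density lborel (\<lambda>x. ennreal (ml_density \<beta> \<mu> m x)))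
      (density lborel (\<lambda>x. ennreal (ml_density \<beta> \<mu> 0 x)))"
    using Suc law_eq_density by simp
  also have "\<dots> = density lborel (\<lambda>x. \<integral>\<^sup>+y. ennreal (ml_density \<beta> \<mu> m (x - y)) * ennreal (ml_density \<beta> \<mu> 0 y) \<partial>lborel)"
    using L law.finite_measure_axioms Suc law_eq_density by (intro convolution_density) auto
  also have "\<dots> = density lborel (\<lambda>x. ennreal (ml_density \<beta> \<mu> (Suc m) x))"
  proof (intro arg_cong[where f = "density lborel"] ext)
    fix x
    have "(\<integral>\<^sup>+y. ennreal (ml_density \<beta> \<mu> m (x - y)) * ennreal (ml_density \<beta> \<mu> 0 y) \<partial>lborel) =
        (\<integral>\<^sup>+y. ennreal (ml_density \<beta> \<mu> m (x - y) * ml_density \<beta> \<mu> 0 y) \<partial>lborel)"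
      by (intro nn_integral_cong) (simp add: density_nonneg ennreal_mult')
    also have "\<dots> = ennreal (ml_density \<beta> \<mu> (Suc m) x)"
      using ml_density_convolution[OF \<beta>_pos \<mu>_pos, of m x]
      by (subst nn_integral_eq_integral) (auto simp: has_bochner_integral_iff density_nonneg)
    finally show "(\<integral>\<^sup>+y. ennreal (ml_density \<beta> \<mu> m (x - y)) * ennreal (ml_density \<beta> \<mu> 0 y) \<partial>lborel) =
        ennreal (ml_density \<beta> \<mu> (Suc m) x)" .
  qed
  finally show ?case .
qed

lemma AE_pos: "AE y in \<nu>. y > 0"
  using law.AE_prob_1[of "{0<..}"] measure_greaterThan[of 0] tail_0 by (simp add: tail_def)

lemma AE_component_pos: "AE z in S. \<forall>i. z i > 0"
proof -
  have "AE z in S. z i > 0" for i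
    by (intro AE_PiM_component AE_pos) (auto intro: law.prob_space_axioms)
  then show ?thesis by (simp add: AE_all_countable)
qed

text \<open>Epochs after the origin have a density and hence no atoms; this later rules out ties
  with arrivals.\<close>

lemma AE_epoch_neq:
  assumes "j > 0"
  shows "AE z in S. epoch z j \<noteq> x"
proof -
  obtain m where j: "j = Suc m" using assms gr0_implies_Suc by blast
  have "AE y in distr S borel (\<lambda>z. epoch z j). y \<noteq> x"
    unfolding j distr_epoch_Suc using AE_lborel_singleton[of x] by (subst AE_density) auto
  then show ?thesis by (subst (asm) AE_distr_iff) auto
qed

text \<open>A Chernoff bound: the Laplace transform of epoch \<open>j\<close> at 1 is q^j with q <
  1, because gaps are positive, so the probability that all epochs stay below n is at most e^n q^j
  for every \<open>j\<close>.\<close>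

lemma AE_epoch_unbounded: "AE z in S. \<forall>x. \<exists>j. epoch z j > x"
proof -
  define p where "p = (\<integral>\<^sup>+y. ennreal (exp (- y)) \<partial>\<nu>)"
  have int: "integrable \<nu> (\<lambda>y. exp (- y))"
    by (rule law.integrable_const_bound[of _ 1]) (use AE_pos in auto)
  define q where "q = law.expectation (\<lambda>y. exp (- y))"
  have q1: "q < 1"
    unfolding q_def using AE_pos by (intro law.expectation_less int) auto
  have q0: "q \<ge> 0" unfolding q_def by simp
  have p: "p = ennreal q"
    unfolding p_def q_def by (rule nn_integral_eq_integral[OF int]) simp
  have lap: "(\<integral>\<^sup>+z. ennreal (exp (- epoch z j)) \<partial>S) = ennreal (q ^ j)" for j
  proof (induction j)
    case 0
    then show ?case by (simp add: P.emeasure_space_1)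
  next
    case (Suc j)
    have "(\<integral>\<^sup>+z. ennreal (exp (- epoch z (Suc j))) \<partial>S) =
        (\<integral>\<^sup>+z. ennreal (exp (- epoch z j)) * ennreal (exp (- z j)) \<partial>S)"
      by (intro nn_integral_cong) (simp add: epoch_Suc flip: ennreal_mult' exp_add)
    also have "\<dots> = (\<integral>\<^sup>+z. \<integral>\<^sup>+y. ennreal (exp (- epoch z j)) * ennreal (exp (- y)) \<partial>\<nu> \<partial>S)"
      by (rule nn_integral_epoch_step) measurable
    also have "\<dots> = (\<integral>\<^sup>+z. ennreal (exp (- epoch z j)) \<partial>S) * p"
      by (simp add: nn_integral_cmult nn_integral_multc p_def)
    finally show ?case using Suc q0 by (simp add: p ennreal_mult'[symmetric] mult.commute)
  qed
  have "AE z in S. \<exists>j. epoch z j > real n" for n :: nat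
  proof -
    let ?B = "{z \<in> space S. \<forall>j. epoch z j \<le> real n}"
    have B: "?B \<in> sets S" by measurable
    have "emeasure S ?B \<le> ennreal (exp (real n) * q ^ j)" for j
    proof -
      have "emeasure S ?B = (\<integral>\<^sup>+z. indicator ?B z \<partial>S)" using B by simp
      also have "\<dots> \<le> (\<integral>\<^sup>+z. ennreal (exp (real n)) * ennreal (exp (- epoch z j)) \<partial>S)"
        by (intro nn_integral_mono) (auto simp: indicator_def simp flip: ennreal_mult' exp_add)
      also have "\<dots> = ennreal (exp (real n) * q ^ j)"
        using q0 by (simp add: nn_integral_cmult lap ennreal_mult')
      finally show ?thesis .
    qed
    moreover have "(\<lambda>j. ennreal (exp (real n) * q ^ j)) \<longlonglongrightarrow> ennreal (exp (real n) * 0)"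
      using q0 q1 by (intro tendsto_ennrealI tendsto_intros LIMSEQ_realpow_zero) auto
    ultimately have "emeasure S ?B \<le> ennreal (exp (real n) * 0)"
      by (intro LIMSEQ_le_const) auto
    then have "emeasure S ?B = 0" by simp
    then show ?thesis
      using B by (intro AE_I[of _ _ ?B]) (auto simp: not_less)
  qed
  then have "AE z in S. \<forall>n. \<exists>j. epoch z j > real n" by (simp add: AE_all_countable)
  then show ?thesis
  proof eventually_elim
    case (elim z)
    show ?case
    proof
      fix x
      obtain n where "x < real n" using reals_Archimedean2 by blast
      with elim show "\<exists>j. epoch z j > x" by (meson less_trans)
    qed
  qed
qed

end

section \<open>Residual life and last epoch before a time\<close>

definition residual_exceeds :: "real \<Rightarrow> real \<Rightarrow> (nat \<Rightarrow> real) \<Rightarrow> bool" where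
  "residual_exceeds t T z \<longleftrightarrow> (\<exists>j. epoch z j \<le> T \<and> T + t < epoch z (Suc j))"

text \<open>The \<open>LEAST\<close> index is that of the gap straddling T. If no epoch exceeds T
  the value is arbitrary, which concerns a null set of \<open>S\<close>.\<close>

definition last_epoch :: "real \<Rightarrow> (nat \<Rightarrow> real) \<Rightarrow> real" where
  "last_epoch T z = epoch z (LEAST j. T < epoch z (Suc j))"

lemma epoch_nonneg: "(\<And>i. z i > 0) \<Longrightarrow> epoch z j \<ge> 0"
  by (simp add: epoch_def sum_nonneg less_imp_le)

lemma measurable_residual_exceeds [measurable (raw)]:
  assumes [measurable]: "f \<in> measurable N (\<Pi>\<^sub>M i\<in>(UNIV :: nat set). borel)" "T \<in> borel_measurable N"
  shows "Measurable.pred N (\<lambda>x. residual_exceeds t (T x) (f x))"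
  unfolding residual_exceeds_def by measurable

lemma suminf_eq_single:
  fixes f :: "nat \<Rightarrow> ennreal"
  assumes "\<And>j. j \<noteq> i \<Longrightarrow> f j = 0"
  shows "(\<Sum>j. f j) = f i"
  using suminf_finite[of "{i}" f] assms by auto

lemma ex_last_epoch:
  assumes pos: "\<And>i. z i > 0" and unb: "\<exists>j. epoch z j > T" and "T \<ge> 0"
  shows "\<exists>j. epoch z j \<le> T \<and> T < epoch z (Suc j) \<and> last_epoch T z = epoch z j \<and>
    (\<forall>i. i \<noteq> j \<longrightarrow> \<not> (epoch z i \<le> T \<and> T < epoch z (Suc i)))"
proof -
  define j where "j = (LEAST j. T < epoch z (Suc j))"
  obtain k where k: "T < epoch z k" using unb by auto
  have "\<exists>j. T < epoch z (Suc j)"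
  proof (cases k)
    case 0
    with k \<open>T \<ge> 0\<close> show ?thesis by simp
  next
    case (Suc j)
    with k show ?thesis by blast
  qed
  then have j: "T < epoch z (Suc j)" unfolding j_def by (rule LeastI_ex)
  have le: "epoch z j \<le> T"
  proof (cases j)
    case (Suc i)
    then have "\<not> T < epoch z (Suc i)"
      using not_less_Least[of i "\<lambda>j. T < epoch z (Suc j)"] by (simp add: j_def)
    with Suc show ?thesis by simp
  qed (use \<open>T \<ge> 0\<close> in simp)
  have mono: "epoch z i < epoch z k \<longleftrightarrow> i < k" for i k
    using strict_mono_epoch[of z] pos by (simp add: strict_mono_less)
  have "i = j" if "epoch z i \<le> T" "T < epoch z (Suc i)" for i
  proof -
    have "epoch z i < epoch z (Suc j)" "epoch z j < epoch z (Suc i)" using that j le by auto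
    then have "i < Suc j" "j < Suc i" by (simp_all only: mono)
    then show ?thesis by simp
  qed
  moreover have "last_epoch T z = epoch z j" by (simp add: last_epoch_def j_def)
  ultimately show ?thesis using j le by blast
qed

context ml_renewal
begin

definition epoch_law :: "nat \<Rightarrow> real measure" where
  "epoch_law j = distr S borel (\<lambda>z. epoch z j)"

lemma sets_epoch_law [measurable_cong, simp]: "sets (epoch_law j) = sets borel"
  by (simp add: epoch_law_def)

lemma nn_integral_epoch_law:
  "h \<in> borel_measurable borel \<Longrightarrow> (\<integral>\<^sup>+x. h x \<partial>epoch_law j) = (\<integral>\<^sup>+z. h (epoch z j) \<partial>S)"
  unfolding epoch_law_def by (rule nn_integral_distr) measurable

lemma nn_integral_epoch_law_0:
  "h \<in> borel_measurable borel \<Longrightarrow> (\<integral>\<^sup>+x. h x \<partial>epoch_law 0) = h 0"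
  by (simp add: nn_integral_epoch_law P.emeasure_space_1)

lemma nn_integral_epoch_law_Suc:
  assumes [measurable]: "h \<in> borel_measurable borel"
  shows "(\<integral>\<^sup>+x. h x \<partial>epoch_law (Suc m)) = (\<integral>\<^sup>+x. ennreal (ml_density \<beta> \<mu> m x) * h x \<partial>lborel)"
  unfolding epoch_law_def distr_epoch_Suc by (rule nn_integral_density) measurable

lemma AE_epoch_law_nonneg: "AE x in epoch_law j. x \<ge> 0"
proof -
  have "AE z in S. epoch z j \<ge> 0"
    using AE_component_pos by eventually_elim (rule epoch_nonneg, simp)
  then show ?thesis unfolding epoch_law_def by (subst AE_distr_iff) auto
qed

text \<open>Given epoch \<open>j\<close> at x \<le> T, the next gap is fresh and reaches beyond T +
  t with probability \<open>tail (T + t - x)\<close>. The constant weight serves the residual life,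
  the case t = 0 with general weight the last epoch.\<close>

lemma nn_integral_straddle:
  assumes [measurable]: "h \<in> borel_measurable borel" and "t \<ge> 0"
  shows "(\<integral>\<^sup>+z. h (epoch z j) * indicator {..T} (epoch z j) * indicator {T + t<..} (epoch z (Suc j)) \<partial>S) =
    (\<integral>\<^sup>+x. h x * indicator {..T} x * ennreal (tail (T + t - x)) \<partial>epoch_law j)"
proof -
  have "(\<integral>\<^sup>+z. h (epoch z j) * indicator {..T} (epoch z j) * indicator {T + t<..} (epoch z (Suc j)) \<partial>S) =
    (\<integral>\<^sup>+z. \<integral>\<^sup>+y. h (epoch z j) * indicator {..T} (epoch z j) * indicator {T + t<..} (epoch z j + y) \<partial>\<nu> \<partial>S)"
    unfolding epoch_Suc by (rule nn_integral_epoch_step) measurable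
  also have "\<dots> = (\<integral>\<^sup>+x. \<integral>\<^sup>+y. h x * indicator {..T} x * indicator {T + t<..} (x + y) \<partial>\<nu> \<partial>epoch_law j)"
    by (rule nn_integral_epoch_law[symmetric]) measurable
  also have "\<dots> = (\<integral>\<^sup>+x. h x * indicator {..T} x * ennreal (tail (T + t - x)) \<partial>epoch_law j)"
  proof (rule nn_integral_cong)
    fix x
    have "(\<integral>\<^sup>+y. h x * indicator {..T} x * indicator {T + t<..} (x + y) \<partial>\<nu>) =
        (\<integral>\<^sup>+y. h x * indicator {..T} x * indicator {T + t - x<..} y \<partial>\<nu>)"
      by (intro nn_integral_cong) (auto simp: indicator_def)
    also have "\<dots> = h x * indicator {..T} x * emeasure \<nu> {T + t - x<..}"
      by (subst nn_integral_cmult) (auto simp: sets_law)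
    also have "\<dots> = h x * indicator {..T} x * ennreal (tail (T + t - x))"
      using assms(2) by (cases "x \<le> T") (auto simp: emeasure_greaterThan)
    finally show "(\<integral>\<^sup>+y. h x * indicator {..T} x * indicator {T + t<..} (x + y) \<partial>\<nu>) =
        h x * indicator {..T} x * ennreal (tail (T + t - x))" .
  qed
  finally show ?thesis .
qed

lemma measurable_last_epoch [measurable]: "last_epoch T \<in> borel_measurable S"
proof -
  have [measurable]: "(\<lambda>z. LEAST j. T < epoch z (Suc j)) \<in> measurable S (count_space UNIV)"
    by measurable
  show ?thesis
    unfolding last_epoch_def by (rule measurable_compose_countable) measurable
qed

text \<open>Almost surely exactly one gap straddles T, so the event is a disjoint union over the
  index of that gap.\<close>

lemma emeasure_residual_exceeds:
  assumes T: "T \<ge> 0" and t: "t \<ge> 0"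
  shows "emeasure S {z \<in> space S. residual_exceeds t T z} =
    (\<Sum>j. \<integral>\<^sup>+x. indicator {..T} x * ennreal (tail (T + t - x)) \<partial>epoch_law j)"
proof -
  have "emeasure S {z \<in> space S. residual_exceeds t T z} =
      (\<integral>\<^sup>+z. indicator {z \<in> space S. residual_exceeds t T z} z \<partial>S)"
    by simp
  also have "\<dots> = (\<integral>\<^sup>+z. (\<Sum>j. 1 * indicator {..T} (epoch z j) * indicator {T + t<..} (epoch z (Suc j))) \<partial>S)"
  proof (rule nn_integral_cong_AE)
    from AE_component_pos AE_epoch_unbounded AE_space
    show "AE z in S. indicator {z \<in> space S. residual_exceeds t T z} z =
      (\<Sum>j. 1 * indicator {..T} (epoch z j) * indicator {T + t<..} (epoch z (Suc j)) :: ennreal)"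
    proof eventually_elim
      case (elim z)
      then obtain j where j: "epoch z j \<le> T" "T < epoch z (Suc j)"
        "\<And>i. i \<noteq> j \<Longrightarrow> \<not> (epoch z i \<le> T \<and> T < epoch z (Suc i))"
        using ex_last_epoch[of z T] T by blast
      have j': "\<not> (epoch z i \<le> T \<and> T + t < epoch z (Suc i))" if "i \<noteq> j" for i
        using j(3)[OF that] t by auto
      have "(\<Sum>j. 1 * indicator {..T} (epoch z j) * indicator {T + t<..} (epoch z (Suc j)) :: ennreal) =
         1 * indicator {..T} (epoch z j) * indicator {T + t<..} (epoch z (Suc j))"
        using j' by (intro suminf_eq_single) (auto simp: indicator_def)
      also have "\<dots> = indicator {z \<in> space S. residual_exceeds t T z} z"
      proof -
        have "residual_exceeds t T z \<longleftrightarrow> T + t < epoch z (Suc j)"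
        proof
          assume "residual_exceeds t T z"
          then obtain i where i: "epoch z i \<le> T" "T + t < epoch z (Suc i)"
            by (auto simp: residual_exceeds_def)
          then have "i = j" using j' by blast
          with i show "T + t < epoch z (Suc j)" by simp
        qed (use j(1) in \<open>auto simp: residual_exceeds_def\<close>)
        with j(1) elim show ?thesis by (auto simp: indicator_def)
      qed
      finally show ?case by simp
    qed
  qed
  also have "\<dots> = (\<Sum>j. \<integral>\<^sup>+z. 1 * indicator {..T} (epoch z j) * indicator {T + t<..} (epoch z (Suc j)) \<partial>S)"
    by (rule nn_integral_suminf) measurable
  also have "\<dots> = (\<Sum>j. \<integral>\<^sup>+x. indicator {..T} x * ennreal (tail (T + t - x)) \<partial>epoch_law j)"
    using t by (subst nn_integral_straddle) simp_all
  finally show ?thesis .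
qed

text \<open>The same decomposition as for the residual life, with \<open>tail (T - x)\<close> in
  place of \<open>tail (T + t - x)\<close>. The quotient of the two is the integrand of
  \<open>residual_tail\<close>.\<close>

lemma nn_integral_last_epoch:
  assumes [measurable]: "h \<in> borel_measurable borel" and T: "T \<ge> 0"
  shows "(\<integral>\<^sup>+z. h (last_epoch T z) \<partial>S) =
    (\<Sum>j. \<integral>\<^sup>+x. h x * indicator {..T} x * ennreal (tail (T - x)) \<partial>epoch_law j)"
proof -
  have "(\<integral>\<^sup>+z. h (last_epoch T z) \<partial>S) =
      (\<integral>\<^sup>+z. (\<Sum>j. h (epoch z j) * indicator {..T} (epoch z j) * indicator {T + 0<..} (epoch z (Suc j))) \<partial>S)"
  proof (rule nn_integral_cong_AE)
    from AE_component_pos AE_epoch_unbounded AE_space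
    show "AE z in S. h (last_epoch T z) =
      (\<Sum>j. h (epoch z j) * indicator {..T} (epoch z j) * indicator {T + 0<..} (epoch z (Suc j)))"
    proof eventually_elim
      case (elim z)
      then obtain j where j: "epoch z j \<le> T" "T < epoch z (Suc j)" "last_epoch T z = epoch z j"
        "\<And>i. i \<noteq> j \<Longrightarrow> \<not> (epoch z i \<le> T \<and> T < epoch z (Suc i))"
        using ex_last_epoch[of z T] T by blast
      have "(\<Sum>j. h (epoch z j) * indicator {..T} (epoch z j) * indicator {T + 0<..} (epoch z (Suc j))) =
         h (epoch z j) * indicator {..T} (epoch z j) * indicator {T + 0<..} (epoch z (Suc j))"
        using j(4) by (intro suminf_eq_single) (auto simp: indicator_def)
      then show ?case using j by simp
    qed
  qed
  also have "\<dots> = (\<Sum>j. \<integral>\<^sup>+z. h (epoch z j) * indicator {..T} (epoch z j) * indicator {T + 0<..} (epoch z (Suc j)) \<partial>S)"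
    by (rule nn_integral_suminf) measurable
  also have "\<dots> = (\<Sum>j. \<integral>\<^sup>+x. h x * indicator {..T} x * ennreal (tail (T - x)) \<partial>epoch_law j)"
    by (subst nn_integral_straddle) simp_all
  finally show ?thesis .
qed

lemma AE_last_epoch_bounds:
  assumes "T \<ge> 0"
  shows "AE z in S. 0 \<le> last_epoch T z \<and> last_epoch T z \<le> T"
  using AE_component_pos AE_epoch_unbounded
proof eventually_elim
  case (elim z)
  then obtain j where "epoch z j \<le> T" "last_epoch T z = epoch z j"
    using ex_last_epoch[of z T] assms by blast
  moreover have "epoch z j \<ge> 0"
    using elim by (intro epoch_nonneg) simp
  ultimately show ?case by simp
qed

text \<open>The index \<open>j = 0\<close> means no renewal up to T and yields the atom
  \<open>tail T\<close>; the index \<open>j = Suc m\<close> yields the term n = m + 1 of the series.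
  From s = T on the value is 1, since the last epoch never exceeds T.\<close>

lemma cdf_last_epoch:
  assumes T: "T \<ge> 0"
  shows "cdf (distr S borel (last_epoch T)) s = F_LJ \<beta> \<mu> T s"
proof -
  have cdf: "cdf (distr S borel (last_epoch T)) s = P.prob {z \<in> space S. last_epoch T z \<le> s}"
    unfolding cdf_def by (subst measure_distr) (auto intro!: arg_cong[where f = P.prob])
  consider "s < 0" | "0 \<le> s" "s \<ge> T" | "0 \<le> s" "s < T" by linarith
  then show ?thesis
  proof cases
    case 1
    have "P.prob {z \<in> space S. last_epoch T z \<le> s} = 0"
    proof (subst P.prob_Collect_eq_0)
      show "AE z in S. \<not> last_epoch T z \<le> s"
        using AE_last_epoch_bounds[OF T] by eventually_elim (use \<open>s < 0\<close> in simp)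
    qed measurable
    with 1 cdf show ?thesis by (simp add: F_LJ_def)
  next
    case 2
    have "P.prob {z \<in> space S. last_epoch T z \<le> s} = 1"
    proof (subst P.prob_Collect_eq_1)
      show "AE z in S. last_epoch T z \<le> s"
        using AE_last_epoch_bounds[OF T] by eventually_elim (use \<open>s \<ge> T\<close> in simp)
    qed measurable
    with 2 cdf show ?thesis by (simp add: F_LJ_def)
  next
    case 3
    define f where "f m x = tail (T - x) * ml_density \<beta> \<mu> m x" for m x
    define a where "a m = (LBINT x:{0..s}. f m x)" for m
    have f_nonneg: "indicator {0..s} x * f m x \<ge> 0" for m x
      using 3 by (auto simp: f_def indicator_def intro!: mult_nonneg_nonneg tail_nonneg density_nonneg)
    have [measurable]: "f m \<in> borel_measurable borel" for m
      unfolding f_def by measurable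
    have a_nonneg: "a m \<ge> 0" for m
      unfolding a_def set_lebesgue_integral_def using f_nonneg by (intro integral_nonneg_AE) auto
    have trm: "(\<integral>\<^sup>+x. indicator {..s} x * indicator {..T} x * ennreal (tail (T - x)) \<partial>epoch_law (Suc m)) = ennreal (a m)" for m
    proof -
      have "(\<integral>\<^sup>+x. indicator {..s} x * indicator {..T} x * ennreal (tail (T - x)) \<partial>epoch_law (Suc m)) =
         (\<integral>\<^sup>+x. ennreal (ml_density \<beta> \<mu> m x) * (indicator {..s} x * indicator {..T} x * ennreal (tail (T - x))) \<partial>lborel)"
        by (rule nn_integral_epoch_law_Suc) measurable
      also have "\<dots> = (\<integral>\<^sup>+x. ennreal (indicator {0..s} x * f m x) \<partial>lborel)"
        using 3 by (intro nn_integral_cong)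
          (auto simp: indicator_def f_def ml_density_nonpos ennreal_mult' density_nonneg tail_nonneg mult.commute)
      finally have eq: "(\<integral>\<^sup>+x. indicator {..s} x * indicator {..T} x * ennreal (tail (T - x)) \<partial>epoch_law (Suc m)) =
        (\<integral>\<^sup>+x. ennreal (indicator {0..s} x * f m x) \<partial>lborel)" .
      have "(\<integral>\<^sup>+x. indicator {..s} x * indicator {..T} x * ennreal (tail (T - x)) \<partial>epoch_law (Suc m)) \<le>
          (\<integral>\<^sup>+x. 1 \<partial>epoch_law (Suc m))"
      proof (rule nn_integral_mono_AE, use AE_epoch_law_nonneg in eventually_elim)
        case (elim x)
        have "tail (T - x) \<le> 1" if "x \<le> T"
          using tail_antimono[of 0 "T - x"] that by (simp add: tail_0)
        then show ?case by (auto simp: indicator_def)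
      qed
      also have "\<dots> < \<infinity>"
        by (simp add: epoch_law_def emeasure_distr P.emeasure_space_1)
      finally have fin: "(\<integral>\<^sup>+x. ennreal (indicator {0..s} x * f m x) \<partial>lborel) < \<infinity>"
        unfolding eq .
      have "a m = enn2real (\<integral>\<^sup>+x. ennreal (indicator {0..s} x * f m x) \<partial>lborel)"
        unfolding a_def set_lebesgue_integral_def real_scaleR_def
        by (rule integral_eq_nn_integral) (auto simp: f_nonneg)
      with fin eq show ?thesis by simp
    qed
    have "ennreal (P.prob {z \<in> space S. last_epoch T z \<le> s}) = (\<integral>\<^sup>+z. indicator {..s} (last_epoch T z) \<partial>S)"
    proof -
      have "(\<integral>\<^sup>+z. indicator {..s} (last_epoch T z) \<partial>S) = (\<integral>\<^sup>+z. indicator {z \<in> space S. last_epoch T z \<le> s} z \<partial>S)"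
        by (intro nn_integral_cong) (auto simp: indicator_def)
      then show ?thesis by (simp add: P.emeasure_eq_measure)
    qed
    also have "\<dots> = (\<Sum>j. \<integral>\<^sup>+x. indicator {..s} x * indicator {..T} x * ennreal (tail (T - x)) \<partial>epoch_law j)"
      using T by (intro nn_integral_last_epoch) auto
    also have "\<dots> = ennreal (tail T) + (\<Sum>m. ennreal (a m))"
      unfolding trm[symmetric] using 3
      by (subst suminf_offset[of _ 1]) (auto simp: nn_integral_epoch_law_0 add.commute)
    finally have sum: "ennreal (P.prob {z \<in> space S. last_epoch T z \<le> s}) = ennreal (tail T) + (\<Sum>m. ennreal (a m))" .
    \<comment> \<open>The sum is formed in \<open>ennreal\<close> first: convergence of the real
      series follows because the total is a probability.\<close>
    then have "(\<Sum>m. ennreal (a m)) \<noteq> \<top>"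
      by (auto simp: ennreal_add_eq_top[symmetric] dest: sym)
    then have "summable a" using a_nonneg by (rule summable_suminf_not_top[rotated])
    then have "(\<Sum>m. ennreal (a m)) = ennreal (\<Sum>m. a m)"
      using a_nonneg by (intro suminf_ennreal2)
    with sum have "ennreal (P.prob {z \<in> space S. last_epoch T z \<le> s}) = ennreal (tail T + (\<Sum>m. a m))"
      using a_nonneg tail_nonneg[OF T] \<open>summable a\<close> by (simp add: suminf_nonneg)
    then have "P.prob {z \<in> space S. last_epoch T z \<le> s} = tail T + (\<Sum>m. a m)"
      using a_nonneg tail_nonneg[OF T] \<open>summable a\<close> by (subst (asm) ennreal_inj) (auto intro!: add_nonneg_nonneg suminf_nonneg)
    moreover have "\<beta> * real (Suc m) * \<mu> ^ Suc m *
           (LBINT z:{0..s}. mittag_leffler \<beta> (- \<mu> * (T - z) powr \<beta>) * z powr (real (Suc m) * \<beta> - 1) *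
              prabhakar \<beta> (real (Suc m) * \<beta> + 1) (real (Suc m) + 1) (- \<mu> * z powr \<beta>)) = a m" for m
      unfolding a_def f_def set_integral_mult_right[symmetric]
    proof (rule set_lebesgue_integral_cong, simp, safe)
      fix z assume "z \<in> {0..s}"
      then have "z \<ge> 0" by simp
      from prabhakar_eq_ml_density[OF \<beta>_pos \<mu>_pos this, of m, symmetric]
      show "\<beta> * real (Suc m) * \<mu> ^ Suc m *
           (mittag_leffler \<beta> (- \<mu> * (T - z) powr \<beta>) * z powr (real (Suc m) * \<beta> - 1) *
              prabhakar \<beta> (real (Suc m) * \<beta> + 1) (real (Suc m) + 1) (- \<mu> * z powr \<beta>)) =
            tail (T - z) * ml_density \<beta> \<mu> m z"
        unfolding tail_def by (simp only: mult_ac)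
    qed
    ultimately show ?thesis
      using 3 unfolding cdf F_LJ_def Let_def by (simp only: if_False if_True not_less[symmetric] tail_def)
  qed
qed

text \<open>Under the law of the last epoch, position s carries the factor
  \<open>tail (T - s)\<close>, the chance that the gap begun at s outlives T. The denominator of the
  integrand cancels it and leaves the chance of outliving T + t.\<close>

lemma residual_tail_eq:
  assumes T: "T \<ge> 0" and t: "t \<ge> 0"
  shows "residual_tail \<beta> \<mu> t T = P.prob {z \<in> space S. residual_exceeds t T z}"
proof -
  let ?L = "distr S borel (last_epoch T)"
  have "real_distribution ?L"
    by (intro P.real_distribution_distr) measurable
  then interpret L: real_distribution ?L .
  have cdf: "cdf ?L = F_LJ \<beta> \<mu> T" using cdf_last_epoch[OF T] by blast
  \<comment> \<open>Two distributions on the line with the same distribution function coincide,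
    which gives the Stieltjes measure of the statement its probabilistic meaning.\<close>
  have L: "interval_measure (F_LJ \<beta> \<mu> T) = ?L"
    unfolding cdf[symmetric]
  proof (rule cdf_unique)
    show "real_distribution (interval_measure (cdf ?L))"
      by (intro real_distribution_interval_measure L.cdf_nondecreasing L.cdf_is_right_cont
        L.cdf_lim_at_bot L.cdf_lim_at_top_prob)
    show "cdf (interval_measure (cdf ?L)) = cdf ?L"
      by (intro cdf_interval_measure L.cdf_nondecreasing L.cdf_is_right_cont
        L.cdf_lim_at_bot L.cdf_lim_at_top_prob)
  qed unfold_locales
  define r where "r s = tail (T - s + t) / tail (T - s)" for s
  have [measurable]: "r \<in> borel_measurable borel" unfolding r_def by measurable
  have r_nonneg: "r s \<ge> 0" if "s \<le> T" for s
    using that t by (auto simp: r_def intro!: divide_nonneg_nonneg tail_nonneg)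
  \<comment> \<open>Also when the denominator vanishes: then so does the numerator.\<close>
  have r_mult: "r s * tail (T - s) = tail (T + t - s)" if "s \<le> T" for s
  proof (cases "tail (T - s) = 0")
    case True
    then have "tail (T + t - s) \<le> 0" using tail_antimono[of "T - s" "T + t - s"] that t by simp
    then show ?thesis using tail_nonneg[of "T + t - s"] that t True by simp
  next
    case False
    then show ?thesis by (simp add: r_def algebra_simps)
  qed
  have "residual_tail \<beta> \<mu> t T = (\<integral>s. indicator {0..T} s * r s \<partial>?L)"
    unfolding residual_tail_def L set_lebesgue_integral_def r_def tail_def by simp
  also have "\<dots> = enn2real (\<integral>\<^sup>+s. ennreal (indicator {0..T} s * r s) \<partial>?L)"
    by (rule integral_eq_nn_integral) (auto simp: indicator_def r_nonneg)
  also have "(\<integral>\<^sup>+s. ennreal (indicator {0..T} s * r s) \<partial>?L) = (\<integral>\<^sup>+z. ennreal (indicator {0..T} (last_epoch T z) * r (last_epoch T z)) \<partial>S)"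
    by (rule nn_integral_distr) measurable
  also have "\<dots> = (\<Sum>j. \<integral>\<^sup>+x. ennreal (indicator {0..T} x * r x) * indicator {..T} x * ennreal (tail (T - x)) \<partial>epoch_law j)"
    using T by (intro nn_integral_last_epoch) auto
  also have "\<dots> = (\<Sum>j. \<integral>\<^sup>+x. indicator {..T} x * ennreal (tail (T + t - x)) \<partial>epoch_law j)"
  proof (intro suminf_cong nn_integral_cong_AE, use AE_epoch_law_nonneg in eventually_elim)
    case (elim j x)
    then show ?case
      using r_nonneg[of x] tail_nonneg[of "T - x"] r_mult[of x]
      by (auto simp: indicator_def simp flip: ennreal_mult')
  qed
  also have "\<dots> = emeasure S {z \<in> space S. residual_exceeds t T z}"
    using T t by (rule emeasure_residual_exceeds[symmetric])
  finally show ?thesis by (simp add: measure_def)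
qed

end

section \<open>Sample paths of the restless queue\<close>

text \<open>Number of customers that have left when the \<open>k\<close>-th departure opportunity \<open>d k\<close> has passed:
  the opportunity is used iff the next customer to be served has already arrived.\<close>

primrec departures :: "(nat \<Rightarrow> real) \<Rightarrow> (nat \<Rightarrow> real) \<Rightarrow> nat \<Rightarrow> nat" where
  "departures a d 0 = 0"
| "departures a d (Suc k) =
     (if a (Suc (departures a d k)) \<le> d (Suc k) then Suc (departures a d k) else departures a d k)"

text \<open>The least such \<open>k\<close> is the opportunity at which the n-th departure takes
  place. For \<open>n = 0\<close> it is 0, in line with the convention that departure 0 is at time
  0.\<close>

definition departure_index :: "(nat \<Rightarrow> real) \<Rightarrow> (nat \<Rightarrow> real) \<Rightarrow> nat \<Rightarrow> nat" where
  "departure_index a d n = (LEAST k. departures a d k = n)"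

lemma departures_cong:
  "(\<And>i. i \<le> k \<Longrightarrow> d i = d' i) \<Longrightarrow> departures a d k = departures a d' k"
  by (induction k) auto

definition epoch_sequence :: "(nat \<Rightarrow> real) \<Rightarrow> bool" where
  "epoch_sequence a \<longleftrightarrow> a 0 = 0 \<and> strict_mono a \<and> (\<forall>x. \<exists>k. x < a k)"

text \<open>A Galois connection between a counting path and its epochs. Unboundedness makes the set
  finite, so that \<open>Max\<close> is a genuine maximum.\<close>

lemma epoch_sequence_Max_iff:
  assumes "epoch_sequence a" "t \<ge> 0"
  shows "k \<le> Max {k. a k \<le> t} \<longleftrightarrow> a k \<le> t"
proof -
  obtain K where K: "t < a K" using assms by (auto simp: epoch_sequence_def)
  have mono: "a i \<le> a j" if "i \<le> j" for i j
    using assms(1) that by (auto simp: epoch_sequence_def strict_mono_less_eq)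
  have fin: "finite {k. a k \<le> t}"
  proof (rule finite_subset)
    show "{k. a k \<le> t} \<subseteq> {..K}"
    proof
      fix k assume "k \<in> {k. a k \<le> t}"
      then have "a k < a K" using K by simp
      then show "k \<in> {..K}" using mono[of K k] by (cases "k \<le> K") auto
    qed
  qed simp
  have ne: "{k. a k \<le> t} \<noteq> {}" using assms by (auto simp: epoch_sequence_def intro!: exI[of _ 0])
  show ?thesis
  proof
    assume "k \<le> Max {k. a k \<le> t}"
    then have "a k \<le> a (Max {k. a k \<le> t})" by (rule mono)
    also have "\<dots> \<le> t" using Max_in[OF fin ne] by simp
    finally show "a k \<le> t" .
  qed (use fin in \<open>auto intro!: Max_ge\<close>)
qed

text \<open>The intervals are open on the left and closed on the right because left limits at t need
  the index valid just before t.\<close>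

lemma epoch_sequence_straddle:
  assumes "epoch_sequence a" "t > 0"
  obtains i where "a i < t" "t \<le> a (Suc i)"
proof -
  obtain K where "t \<le> a K" using assms by (auto simp: epoch_sequence_def dest: less_imp_le)
  define k where "k = (LEAST k. t \<le> a k)"
  have k: "t \<le> a k" unfolding k_def using \<open>t \<le> a K\<close> by (rule LeastI)
  then obtain i where i: "k = Suc i" using assms by (cases k) (auto simp: epoch_sequence_def)
  then have "\<not> t \<le> a i"
    using not_less_Least[of i "\<lambda>k. t \<le> a k"] by (simp add: k_def)
  with k i show ?thesis by (intro that[of i]) auto
qed

text \<open>Collects the properties of a single sample path that hold almost surely.
  \<open>Q\<close> keeps its argument \<omega> only to match the type of \<open>arrival_time\<close>
  and \<open>departure_time\<close>.\<close>

locale queue_path =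
  fixes a d :: "nat \<Rightarrow> real" and Na Nd :: "real \<Rightarrow> nat" and Q :: "real \<Rightarrow> 'a \<Rightarrow> real" and \<omega> :: 'a
  assumes arrivals: "epoch_sequence a" and opportunities: "epoch_sequence d"
    and no_ties: "i > 0 \<Longrightarrow> j > 0 \<Longrightarrow> a i \<noteq> d j"
    and Na: "t \<ge> 0 \<Longrightarrow> Na t = Max {k. a k \<le> t}"
    and Nd: "t \<ge> 0 \<Longrightarrow> Nd t = Max {k. d k \<le> t}"
    and Q: "t \<ge> 0 \<Longrightarrow> Q t \<omega> = skorokhod_reflection (\<lambda>s. real (Na s) - real (Nd s)) t"
begin

abbreviation "dep \<equiv> departures a d"

lemma a_0: "a 0 = 0" and d_0: "d 0 = 0"
  using arrivals opportunities by (auto simp: epoch_sequence_def)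

lemma a_less: "a i < a j \<longleftrightarrow> i < j" and d_less: "d i < d j \<longleftrightarrow> i < j"
  using arrivals opportunities by (auto simp: epoch_sequence_def strict_mono_less)

lemma a_le: "a i \<le> a j \<longleftrightarrow> i \<le> j" and d_le: "d i \<le> d j \<longleftrightarrow> i \<le> j"
  using arrivals opportunities by (auto simp: epoch_sequence_def strict_mono_less_eq)

lemma a_nonneg: "a i \<ge> 0" and d_nonneg: "d i \<ge> 0"
  using a_le[of 0 i] d_le[of 0 i] by (simp_all add: a_0 d_0)

lemma le_Na: "t \<ge> 0 \<Longrightarrow> k \<le> Na t \<longleftrightarrow> a k \<le> t" and le_Nd: "t \<ge> 0 \<Longrightarrow> k \<le> Nd t \<longleftrightarrow> d k \<le> t"
  using epoch_sequence_Max_iff arrivals opportunities by (simp_all add: Na Nd)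

lemma Na_eq:
  assumes "a i \<le> t" "t < a (Suc i)"
  shows "Na t = i"
proof -
  have t: "t \<ge> 0" using assms(1) a_nonneg[of i] by simp
  then have "i \<le> Na t" "\<not> Suc i \<le> Na t" using assms by (simp_all add: le_Na)
  then show ?thesis by simp
qed

lemma Nd_eq:
  assumes "d i \<le> t" "t < d (Suc i)"
  shows "Nd t = i"
proof -
  have t: "t \<ge> 0" using assms(1) d_nonneg[of i] by simp
  then have "i \<le> Nd t" "\<not> Suc i \<le> Nd t" using assms by (simp_all add: le_Nd)
  then show ?thesis by simp
qed

lemma Na_mono: "0 \<le> s \<Longrightarrow> s \<le> t \<Longrightarrow> Na s \<le> Na t"
  using le_Na[of s "Na s"] le_Na[of t "Na s"] by simp

lemma Nd_mono: "0 \<le> s \<Longrightarrow> s \<le> t \<Longrightarrow> Nd s \<le> Nd t"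
  using le_Nd[of s "Nd s"] le_Nd[of t "Nd s"] by simp

lemma Nd_d: "Nd (d k) = k"
  by (rule Nd_eq) (auto simp: d_less)

lemma dep_mono: "i \<le> j \<Longrightarrow> dep i \<le> dep j"
  by (induction j rule: dec_induct) auto

lemma unused_mono: "i \<le> j \<Longrightarrow> real i - real (dep i) \<le> real j - real (dep j)"
  by (induction j rule: dec_induct) auto

lemma dep_le_Na: "dep k \<le> Na (d k)"
proof (induction k)
  case (Suc k)
  have "Na (d k) \<le> Na (d (Suc k))"
    by (intro Na_mono) (auto simp: d_nonneg d_le)
  with Suc show ?case using le_Na[OF d_nonneg[of "Suc k"], of "Suc (dep k)"] by auto
qed simp

lemma unused_upper:
  assumes "0 \<le> s" "s \<le> t"
  shows "real (Nd s) - real (Na s) \<le> real (Nd t) - real (dep (Nd t))"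
proof -
  have "dep (Nd s) \<le> Na (d (Nd s))" by (rule dep_le_Na)
  also have "\<dots> \<le> Na s"
    using assms le_Nd[of s "Nd s"] by (intro Na_mono) (auto simp: d_nonneg)
  finally have "real (Nd s) - real (Na s) \<le> real (Nd s) - real (dep (Nd s))" by simp
  also have "\<dots> \<le> real (Nd t) - real (dep (Nd t))"
    using assms by (intro unused_mono Nd_mono)
  finally show ?thesis .
qed

lemma unused_attained: "\<exists>s\<in>{0..d k}. max (real (Nd s) - real (Na s)) 0 = real k - real (dep k)"
proof (induction k)
  case 0
  have "Na 0 = 0" by (rule Na_eq) (auto simp: a_0 a_less[of 0, unfolded a_0])
  moreover have "Nd 0 = 0" using Nd_d[of 0] by (simp add: d_0)
  ultimately show ?case by (auto simp: d_0)
next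
  case (Suc k)
  show ?case
  proof (cases "a (Suc (dep k)) \<le> d (Suc k)")
    case True
    have "d k \<le> d (Suc k)" by (simp add: d_le)
    with Suc True show ?thesis by (auto intro!: bexI)
  next
    case False
    then have "\<not> Suc (dep k) \<le> Na (d (Suc k))" by (simp add: le_Na d_nonneg)
    then have "real (Na (d (Suc k))) \<le> real (dep k)" by simp
    moreover have "real (Nd (d (Suc k))) - real (Na (d (Suc k))) \<le> real (Nd (d (Suc k))) - real (dep (Nd (d (Suc k))))"
      by (rule unused_upper) (auto simp: d_nonneg)
    moreover have "real (Suc k) - real (dep (Suc k)) \<ge> 0"
      using unused_mono[of 0 "Suc k"] by simp
    ultimately have "max (real (Nd (d (Suc k))) - real (Na (d (Suc k)))) 0 = real (Suc k) - real (dep (Suc k))"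
      using False by (simp add: Nd_d)
    then show ?thesis by (intro bexI[of _ "d (Suc k)"]) (auto simp: d_nonneg)
  qed
qed

lemma Q_eq:
  assumes t: "t \<ge> 0"
  shows "Q t \<omega> = real (Na t) - real (dep (Nd t))"
proof -
  have "(SUP s\<in>{0..t}. max (- (real (Na s) - real (Nd s))) 0) = real (Nd t) - real (dep (Nd t))"
  proof (rule cSup_eq_maximum)
    obtain s where "s \<in> {0..d (Nd t)}" "max (real (Nd s) - real (Na s)) 0 = real (Nd t) - real (dep (Nd t))"
      using unused_attained[of "Nd t"] by blast
    moreover have "d (Nd t) \<le> t" using le_Nd[OF t, of "Nd t"] by simp
    ultimately show "real (Nd t) - real (dep (Nd t)) \<in> (\<lambda>s. max (- (real (Na s) - real (Nd s))) 0) ` {0..t}"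
      by (intro image_eqI[of _ _ s]) auto
  next
    fix x assume "x \<in> (\<lambda>s. max (- (real (Na s) - real (Nd s))) 0) ` {0..t}"
    then show "x \<le> real (Nd t) - real (dep (Nd t))"
      using unused_upper[of _ t] unused_mono[of 0 "Nd t"] by auto
  qed
  then show ?thesis using Q[OF t] by (simp add: skorokhod_reflection_def)
qed

section \<open>Jumps of the queue length\<close>

lemma Lim_left:
  assumes "a i < t" "t \<le> a (Suc i)" "d j < t" "t \<le> d (Suc j)"
  shows "Lim (at_left t) (\<lambda>s. Q s \<omega>) = real i - real (dep j)"
proof (rule tendsto_Lim)
  have "eventually (\<lambda>s. s \<in> {max (a i) (d j)<..<t}) (at_left t)"
    using assms by (intro eventually_at_left_real) auto
  then have "eventually (\<lambda>s. Q s \<omega> = real i - real (dep j)) (at_left t)"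
  proof eventually_elim
    case (elim s)
    then have "Na s = i" "Nd s = j" using assms by (auto intro!: Na_eq Nd_eq)
    moreover have "s \<ge> 0" using elim a_nonneg[of i] by auto
    ultimately show ?case by (simp add: Q_eq)
  qed
  then show "((\<lambda>s. Q s \<omega>) \<longlongrightarrow> real i - real (dep j)) (at_left t)"
    by (rule tendsto_eventually)
qed simp

lemma jump_iff:
  assumes "t > 0"
  shows "Q t \<omega> = Lim (at_left t) (\<lambda>s. Q s \<omega>) + 1 \<longleftrightarrow> (\<exists>i. t = a (Suc i))" (is ?up)
    and "Q t \<omega> = Lim (at_left t) (\<lambda>s. Q s \<omega>) - 1 \<longleftrightarrow> (\<exists>j. t = d (Suc j) \<and> dep (Suc j) = Suc (dep j))" (is ?down)
proof -
  obtain i where i: "a i < t" "t \<le> a (Suc i)"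
    using epoch_sequence_straddle[OF arrivals assms] .
  obtain j where j: "d j < t" "t \<le> d (Suc j)"
    using epoch_sequence_straddle[OF opportunities assms] .
  have i_eq: "i' = i" if "t = a (Suc i')" for i'
    using i that by (simp add: a_less a_le)
  have j_eq: "j' = j" if "t = d (Suc j')" for j'
    using j that by (simp add: d_less d_le)
  have Na_t: "Na t = (if t = a (Suc i) then Suc i else i)"
    using i by (auto intro!: Na_eq simp: a_less)
  have Nd_t: "Nd t = (if t = d (Suc j) then Suc j else j)"
    using j by (auto intro!: Nd_eq simp: d_less)
  have tie: "\<not> (t = a (Suc i) \<and> t = d (Suc j))"
    using no_ties[of "Suc i" "Suc j"] by auto
  have q: "Q t \<omega> = real (Na t) - real (dep (Nd t))"
    using assms by (intro Q_eq) simp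
  note L = Lim_left[OF i j]
  have dep: "dep (Suc j) = dep j \<or> dep (Suc j) = Suc (dep j)" by simp
  have up: "(\<exists>i. t = a (Suc i)) \<longleftrightarrow> t = a (Suc i)"
    using i_eq by blast
  have down: "(\<exists>j. t = d (Suc j) \<and> dep (Suc j) = Suc (dep j)) \<longleftrightarrow> t = d (Suc j) \<and> dep (Suc j) = Suc (dep j)"
    using j_eq by blast
  consider "t = a (Suc i)" "t \<noteq> d (Suc j)" | "t \<noteq> a (Suc i)" "t = d (Suc j)" | "t \<noteq> a (Suc i)" "t \<noteq> d (Suc j)"
    using tie by blast
  then have "?up \<and> ?down"
  proof cases
    case 1
    have "Na t = Suc i" unfolding Na_t by (rule if_P[OF 1(1)])
    moreover have "Nd t = j" unfolding Nd_t by (rule if_not_P[OF 1(2)])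
    ultimately have "Q t \<omega> = real (Suc i) - real (dep j)" by (simp only: q)
    with 1 show ?thesis unfolding up down L by simp
  next
    case 2
    have "Na t = i" unfolding Na_t by (rule if_not_P[OF 2(1)])
    moreover have "Nd t = Suc j" unfolding Nd_t by (rule if_P[OF 2(2)])
    ultimately have "Q t \<omega> = real i - real (dep (Suc j))" by (simp only: q)
    then have "Q t \<omega> = real i - real (dep j) + 1 \<longleftrightarrow> False"
      "Q t \<omega> = real i - real (dep j) - 1 \<longleftrightarrow> dep (Suc j) = Suc (dep j)" using dep by auto
    with 2 show ?thesis unfolding up down L by blast
  next
    case 3
    have "Na t = i" unfolding Na_t by (rule if_not_P[OF 3(1)])
    moreover have "Nd t = j" unfolding Nd_t by (rule if_not_P[OF 3(2)])
    ultimately have "Q t \<omega> = real i - real (dep j)" by (simp only: q)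
    with 3 show ?thesis unfolding up down L by simp
  qed
  then show ?up ?down by blast+
qed

lemma arrival_time_eq: "arrival_time Q n \<omega> = a n"
proof (induction n)
  case 0
  show ?case by (simp add: a_0)
next
  case (Suc n)
  have "(LEAST t. t > a n \<and> Q t \<omega> = Lim (at_left t) (\<lambda>s. Q s \<omega>) + 1) = a (Suc n)"
  proof (rule Least_equality)
    have "a (Suc n) > 0" using a_less[of 0 "Suc n"] by (simp add: a_0)
    then show "a (Suc n) > a n \<and> Q (a (Suc n)) \<omega> = Lim (at_left (a (Suc n))) (\<lambda>s. Q s \<omega>) + 1"
      using jump_iff(1)[of "a (Suc n)"] by (auto simp: a_less)
  next
    fix t assume t: "t > a n \<and> Q t \<omega> = Lim (at_left t) (\<lambda>s. Q s \<omega>) + 1"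
    then have "t > 0" using a_nonneg[of n] by simp
    with t obtain i where "t = a (Suc i)" using jump_iff(1)[of t] by auto
    with t show "a (Suc n) \<le> t" by (simp add: a_less a_le)
  qed
  then show ?case by (simp add: Suc)
qed

text \<open>The count moves in steps of at most one and cannot stay at \<open>n\<close> for ever:
  opportunities are unbounded, and one that comes after arrival \<open>Suc n\<close> would be
  used.\<close>

lemma ex_dep: "\<exists>k. dep k = n"
proof (induction n)
  case 0
  show ?case by (intro exI[of _ 0]) simp
next
  case (Suc n)
  then obtain k0 where k0: "dep k0 = n" by blast
  show ?case
  proof (rule ccontr)
    assume no: "\<nexists>k. dep k = Suc n"
    have const: "dep k = n" if "k \<ge> k0" for k
      using that
    proof (induction k rule: dec_induct)
      case (step k)
      then have "dep (Suc k) = n \<or> dep (Suc k) = Suc n" by auto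
      with no show ?case by blast
    qed (rule k0)
    obtain k where k: "a (Suc n) < d k" using opportunities by (auto simp: epoch_sequence_def)
    define k' where "k' = max k k0"
    have "d k \<le> d (Suc k')" unfolding d_le k'_def by simp
    then have "dep (Suc k') = Suc n" using k const[of k'] by (simp add: k'_def)
    with no show False by blast
  qed
qed

lemma dep_departure_index: "dep (departure_index a d n) = n"
  unfolding departure_index_def using ex_dep[of n] by (rule LeastI_ex)

lemma departure_index_le: "n \<le> dep k \<Longrightarrow> departure_index a d n \<le> k"
proof (rule ccontr)
  assume le: "n \<le> dep k" and "\<not> departure_index a d n \<le> k"
  then have less: "k < departure_index a d n" by simp
  then have "dep k \<le> n" using dep_mono[of k "departure_index a d n"] dep_departure_index by simp
  with le have "dep k = n" by simp
  then have "departure_index a d n \<le> k" unfolding departure_index_def by (rule Least_le)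
  with less show False by simp
qed

lemma departure_index_Suc:
  obtains j where "departure_index a d (Suc n) = Suc j" "dep j = n" "departure_index a d n \<le> j"
proof -
  let ?K = "departure_index a d (Suc n)"
  have K: "dep ?K = Suc n" by (rule dep_departure_index)
  then obtain j where j: "?K = Suc j" by (cases ?K) auto
  have "\<not> Suc n \<le> dep j" using departure_index_le[of "Suc n" j] j by auto
  moreover have "dep (Suc j) \<le> Suc (dep j)" by simp
  ultimately have "dep j = n" using K unfolding j by simp
  moreover from this have "departure_index a d n \<le> j" by (intro departure_index_le) simp
  ultimately show ?thesis using j that by blast
qed

lemma departure_time_eq: "departure_time Q n \<omega> = d (departure_index a d n)"
proof (induction n)
  case 0
  have "departure_index a d 0 = 0" using departure_index_le[of 0 0] by simp
  then show ?case by (simp add: d_0)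
next
  case (Suc n)
  let ?K = "departure_index a d"
  obtain j where j: "?K (Suc n) = Suc j" "dep j = n" "?K n \<le> j"
    by (rule departure_index_Suc)
  have "(LEAST t. t > d (?K n) \<and> Q t \<omega> = Lim (at_left t) (\<lambda>s. Q s \<omega>) - 1) = d (Suc j)"
  proof (rule Least_equality)
    have "d (Suc j) > 0" using d_less[of 0 "Suc j"] by (simp add: d_0)
    moreover have "dep (Suc j) = Suc (dep j)"
      using dep_departure_index[of "Suc n"] unfolding j(1,2) .
    ultimately show "d (Suc j) > d (?K n) \<and> Q (d (Suc j)) \<omega> = Lim (at_left (d (Suc j))) (\<lambda>s. Q s \<omega>) - 1"
      using jump_iff(2)[of "d (Suc j)"] j(3) by (auto simp: d_less simp del: departures.simps)
  next
    fix t assume t: "t > d (?K n) \<and> Q t \<omega> = Lim (at_left t) (\<lambda>s. Q s \<omega>) - 1"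
    then have "t > 0" using d_nonneg[of "?K n"] by simp
    with t obtain i where i: "t = d (Suc i)" "dep (Suc i) = Suc (dep i)"
      using jump_iff(2)[of t] by auto
    with t have "?K n \<le> i" by (simp add: d_less)
    then have "n \<le> dep i" using dep_mono[of "?K n" i] dep_departure_index by simp
    then have "Suc j \<le> Suc i" using i(2) departure_index_le[of "Suc n" "Suc i"] unfolding j(1) by simp
    then show "d (Suc j) \<le> t" unfolding i(1) d_le .
  qed
  then show ?case by (simp add: Suc j(1))
qed

text \<open>Time is measured from departure \<open>n\<close>, which is opportunity \<open>k\<close>.
  Opportunity \<open>Suc j\<close>, used by departure \<open>Suc n\<close>, ends the one gap that
  straddles T, so the service time is the residual life at T of the process restarted there.\<close>

lemma service_time_gt_iff:
  fixes n :: nat and t :: real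
  assumes t: "t \<ge> 0"
  defines "k \<equiv> departure_index a d n"
  defines "T \<equiv> max (a (Suc n) - d k) 0"
  shows "service_time Q (Suc n) \<omega> > t \<longleftrightarrow> (\<exists>j. d (k + j) - d k \<le> T \<and> T + t < d (k + Suc j) - d k)"
proof -
  obtain j where j: "departure_index a d (Suc n) = Suc j" "dep j = n" "k \<le> j"
    unfolding k_def by (rule departure_index_Suc)
  define i where "i = j - k"
  have ki: "k + i = j" "k + Suc i = Suc j" using j(3) by (simp_all add: i_def)
  have "dep (Suc j) = Suc n" using dep_departure_index[of "Suc n"] j(1) by simp
  then have "a (Suc n) \<le> d (Suc j)" using j(2) by (simp split: if_splits)
  \<comment> \<open>Strictness, needed for T to lie properly inside the gap, is where the absence of
    ties enters.\<close>
  then have "a (Suc n) < d (Suc j)" using no_ties[of "Suc n" "Suc j"] by simp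
  moreover have "d k < d (Suc j)" using j(3) by (simp add: d_less)
  ultimately have up: "T < d (k + Suc i) - d k" by (simp add: T_def ki)
  have low: "d (k + i) - d k \<le> T"
  proof (cases i)
    case (Suc i')
    then have j': "j = Suc (k + i')" using ki by simp
    have "dep k \<le> dep (k + i')" "dep (k + i') \<le> dep j" using j' by (auto intro!: dep_mono simp del: departures.simps)
    then have "dep (k + i') = n" using dep_departure_index[of n] j(2) by (simp add: k_def)
    moreover have "dep (Suc (k + i')) = n" using j(2) j' by simp
    ultimately have "\<not> a (Suc n) \<le> d (Suc (k + i'))" by (auto split: if_splits)
    then show ?thesis by (simp add: T_def ki j')
  qed (simp add: T_def)
  have uniq: "i' = i" if "d (k + i') - d k \<le> T" "T < d (k + Suc i') - d k" for i'
  proof -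
    have "d (k + i') < d (k + Suc i)" "d (k + i) < d (k + Suc i')"
      using that up low by linarith+
    then have "k + i' < k + Suc i" "k + i < k + Suc i'" by (simp_all only: d_less)
    then show ?thesis by simp
  qed
  have "service_time Q (Suc n) \<omega> = d (k + Suc i) - d k - T"
    unfolding ki(2) T_def by (simp add: service_time_def departure_time_eq arrival_time_eq j(1) k_def max_def
        del: departure_time.simps arrival_time.simps)
  then have "service_time Q (Suc n) \<omega> > t \<longleftrightarrow> T + t < d (k + Suc i) - d k" by auto
  also have "\<dots> \<longleftrightarrow> (\<exists>j. d (k + j) - d k \<le> T \<and> T + t < d (k + Suc j) - d k)"
  proof
    assume "T + t < d (k + Suc i) - d k"
    with low show "\<exists>j. d (k + j) - d k \<le> T \<and> T + t < d (k + Suc j) - d k" by blast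
  next
    assume "\<exists>j. d (k + j) - d k \<le> T \<and> T + t < d (k + Suc j) - d k"
    then obtain i' where i': "d (k + i') - d k \<le> T" "T + t < d (k + Suc i') - d k" by blast
    then have "T < d (k + Suc i') - d k" using t by linarith
    with uniq i' show "T + t < d (k + Suc i) - d k" by blast
  qed
  finally show ?thesis .
qed

end

section \<open>The conditional law of the service time\<close>

lemma epoch_shift: "epoch (\<lambda>i. z (k + i)) j = epoch z (k + j) - epoch z k"
  by (induction j) (simp_all add: epoch_Suc)

lemma (in ml_renewal) AE_epoch_sequence: "AE z in S. epoch_sequence (epoch z)"
  using AE_component_pos AE_epoch_unbounded
  by eventually_elim (simp add: epoch_sequence_def strict_mono_epoch)

lemma fractional_poisson_process_renewal:
  assumes "prob_space M" and N: "fractional_poisson_process M \<beta> \<mu> N" and \<beta>: "\<beta> > 0" and \<mu>: "\<mu> > 0"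
  obtains \<nu> Z where "ml_renewal \<nu> \<beta> \<mu>" "\<And>i. Z i \<in> borel_measurable M"
    "distr M (\<Pi>\<^sub>M i\<in>UNIV. borel) (\<lambda>\<omega> i. Z i \<omega>) = (\<Pi>\<^sub>M i\<in>UNIV. \<nu>)"
    "AE \<omega> in M. \<forall>t\<ge>0. N t \<omega> = Max {k. epoch (\<lambda>i. Z i \<omega>) k \<le> t}"
proof -
  interpret prob_space M by fact
  obtain Y :: "nat \<Rightarrow> 'a \<Rightarrow> real" where indep: "indep_vars (\<lambda>_. borel) Y {1..}"
    and Y: "\<And>j. j \<ge> 1 \<Longrightarrow> mittag_leffler_distributed M \<beta> \<mu> (Y j)"
    and NY: "AE \<omega> in M. \<forall>t\<ge>0. N t \<omega> = Max {k. (\<Sum>j=1..k. Y j \<omega>) \<le> t}"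
    using N unfolding fractional_poisson_process_def by blast
  have Y_meas: "Y j \<in> borel_measurable M" if "j \<ge> 1" for j
    using Y[OF that] by (simp add: mittag_leffler_distributed_def)
  have law: "ml_renewal (distr M borel (Y j)) \<beta> \<mu>" if "j \<ge> 1" for j
  proof -
    have [measurable]: "Y j \<in> borel_measurable M" by (rule Y_meas[OF that])
    have "measure (distr M borel (Y j)) {t<..} = mittag_leffler \<beta> (- \<mu> * t powr \<beta>)" if "t \<ge> 0" for t
    proof -
      have "Y j -` {t<..} \<inter> space M = {\<omega> \<in> space M. Y j \<omega> > t}" by auto
      then show ?thesis
        using Y[OF \<open>j \<ge> 1\<close>] that by (simp add: measure_distr mittag_leffler_distributed_def)
    qed
    then show ?thesis
      using \<beta> \<mu> by (intro ml_renewal.intro ml_renewal_axioms.intro prob_space_distr) auto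
  qed
  define \<nu> where "\<nu> = distr M borel (Y 1)"
  \<comment> \<open>The tail on [0, \<infinity>) fixes the density, so all gaps share the law of
    \<open>Y 1\<close> and their joint law is a power of it.\<close>
  have \<nu>: "distr M borel (Y j) = \<nu>" if "j \<ge> 1" for j
    using ml_renewal.law_eq_density[OF law[OF that]] ml_renewal.law_eq_density[OF law[of 1]]
    by (simp add: \<nu>_def)
  have ren: "ml_renewal \<nu> \<beta> \<mu>" unfolding \<nu>_def by (rule law) simp
  define Z where "Z i = Y (Suc i)" for i
  have Z: "Z i \<in> borel_measurable M" for i unfolding Z_def by (rule Y_meas) simp
  have sets_\<nu>: "sets \<nu> = sets borel" by (simp add: \<nu>_def)
  have "distr M (\<Pi>\<^sub>M i\<in>{1..}. borel) (\<lambda>\<omega>. \<lambda>i\<in>{1..}. Y i \<omega>) = (\<Pi>\<^sub>M i\<in>{1..}. distr M borel (Y i))"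
    using indep_vars_iff_distr_eq_PiM'[of "{1..}" Y "\<lambda>_. borel"] indep Y_meas by auto
  also have "\<dots> = (\<Pi>\<^sub>M i\<in>{1..}. \<nu>)"
    by (intro PiM_cong) (auto simp: \<nu>)
  finally have 1: "distr M (\<Pi>\<^sub>M i\<in>{1..}. borel) (\<lambda>\<omega>. \<lambda>i\<in>{1..}. Y i \<omega>) = (\<Pi>\<^sub>M i\<in>{1..}. \<nu>)" .
  have "(\<Pi>\<^sub>M i\<in>UNIV. \<nu>) = distr (\<Pi>\<^sub>M i\<in>{1::nat..}. \<nu>) (\<Pi>\<^sub>M i\<in>UNIV. \<nu>) (\<lambda>x. \<lambda>n\<in>UNIV. x (Suc n))"
    using ren by (intro distr_PiM_reindex[symmetric]) (auto simp: ml_renewal_def)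
  also have "\<dots> = distr (\<Pi>\<^sub>M i\<in>{1::nat..}. \<nu>) (\<Pi>\<^sub>M i\<in>UNIV. borel) (\<lambda>x. \<lambda>n\<in>UNIV. x (Suc n))"
    by (intro distr_cong sets_PiM_cong) (auto simp: sets_\<nu>)
  also have "\<dots> = distr M (\<Pi>\<^sub>M i\<in>UNIV. borel) ((\<lambda>x. \<lambda>n\<in>UNIV. x (Suc n)) \<circ> (\<lambda>\<omega>. \<lambda>i\<in>{1..}. Y i \<omega>))"
    unfolding 1[symmetric]
  proof (rule distr_distr)
    show "(\<lambda>\<omega>. \<lambda>i\<in>{1..}. Y i \<omega>) \<in> measurable M (\<Pi>\<^sub>M i\<in>{1..}. borel)"
      by (intro measurable_restrict Y_meas) auto
    show "(\<lambda>x. \<lambda>n\<in>UNIV. x (Suc n)) \<in> measurable (\<Pi>\<^sub>M i\<in>{1::nat..}. borel) (\<Pi>\<^sub>M i\<in>UNIV. (borel :: real measure))"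
      by (intro measurable_restrict measurable_component_singleton) auto
  qed
  also have "((\<lambda>x. \<lambda>n\<in>UNIV. x (Suc n)) \<circ> (\<lambda>\<omega>. \<lambda>i\<in>{1..}. Y i \<omega>)) = (\<lambda>\<omega> i. Z i \<omega>)"
    by (auto simp: Z_def fun_eq_iff)
  finally have 2: "distr M (\<Pi>\<^sub>M i\<in>UNIV. borel) (\<lambda>\<omega> i. Z i \<omega>) = (\<Pi>\<^sub>M i\<in>UNIV. \<nu>)" ..
  have "(\<Sum>j=1..k. Y j \<omega>) = epoch (\<lambda>i. Z i \<omega>) k" for k \<omega>
    by (simp add: epoch_def Z_def sum.atLeast1_atMost_eq)
  with NY have "AE \<omega> in M. \<forall>t\<ge>0. N t \<omega> = Max {k. epoch (\<lambda>i. Z i \<omega>) k \<le> t}" by simp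
  with ren Z 2 show ?thesis by (rule that)
qed

text \<open>The infimum runs over rational times to keep the functional measurable.\<close>

definition path_epoch :: "(real \<Rightarrow> nat) \<Rightarrow> nat \<Rightarrow> real" where
  "path_epoch p k = real_of_ereal (INF q\<in>\<rat> \<inter> {0..}. if k \<le> p q then ereal q else \<infinity>)"

text \<open>Composition with this functional transfers the assumed independence of the counting
  processes to their epochs.\<close>

lemma measurable_path_epoch:
  "path_epoch \<in> measurable (\<Pi>\<^sub>M t\<in>{0..}. count_space UNIV) (\<Pi>\<^sub>M i\<in>UNIV. borel)"
proof (rule measurable_PiM_single')
  show "(\<lambda>p. path_epoch p k) \<in> borel_measurable (\<Pi>\<^sub>M t\<in>{0..}. count_space UNIV)" for k
    unfolding path_epoch_def
  proof (intro borel_measurable_real_of_ereal borel_measurable_INF)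
    show "countable (\<rat> \<inter> {0::real..})" by (intro countable_Int1 countable_rat)
    fix q :: real assume "q \<in> \<rat> \<inter> {0..}"
    then have [measurable]: "(\<lambda>p. p q) \<in> measurable (\<Pi>\<^sub>M t\<in>{0..}. count_space UNIV) (count_space (UNIV :: nat set))"
      by (intro measurable_component_singleton) auto
    show "(\<lambda>p. if k \<le> p q then ereal q else \<infinity>) \<in> borel_measurable (\<Pi>\<^sub>M t\<in>{0..}. count_space UNIV)"
      by measurable
  qed
qed auto

text \<open>The count has reached \<open>k\<close> exactly from epoch \<open>k\<close> on, and the
  rationals beyond that epoch accumulate at it.\<close>

lemma path_epoch_eq:
  assumes e: "epoch_sequence e" and p: "\<And>t. t \<ge> 0 \<Longrightarrow> p t = Max {k. e k \<le> t}"
  shows "path_epoch p = e"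
proof
  fix k
  have le: "k \<le> p q \<longleftrightarrow> e k \<le> q" if "q \<ge> 0" for q
    using epoch_sequence_Max_iff[OF e that] p[OF that] by simp
  have "(INF q\<in>\<rat> \<inter> {0..}. if k \<le> p q then ereal q else \<infinity>) = ereal (e k)"
  proof (rule antisym)
    show "ereal (e k) \<le> (INF q\<in>\<rat> \<inter> {0..}. if k \<le> p q then ereal q else \<infinity>)"
      by (rule INF_greatest) (auto simp: le)
    show "(INF q\<in>\<rat> \<inter> {0..}. if k \<le> p q then ereal q else \<infinity>) \<le> ereal (e k)"
    proof (rule ccontr)
      assume "\<not> ?thesis"
      then have "ereal (e k) < (INF q\<in>\<rat> \<inter> {0..}. if k \<le> p q then ereal q else \<infinity>)"
        by (simp only: not_le)
      from ereal_dense2[OF this] obtain r where r: "ereal (e k) < ereal r"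
          "ereal r < (INF q\<in>\<rat> \<inter> {0..}. if k \<le> p q then ereal q else \<infinity>)"
        by blast
      then obtain q where q: "q \<in> \<rat>" "e k < q" "q < r"
        using Rats_dense_in_real[of "e k" r] by auto
      have "e 0 \<le> e k" using e strict_mono_less_eq[of e 0 k] by (simp add: epoch_sequence_def)
      then have "q \<ge> 0" using e q by (simp add: epoch_sequence_def)
      then have le_q: "(INF q\<in>\<rat> \<inter> {0..}. if k \<le> p q then ereal q else \<infinity>) \<le> ereal q"
        using q by (intro INF_lower2[of q]) (auto simp: le)
      have "ereal r < ereal q" using r(2) le_q by (rule order_less_le_trans)
      with q(3) show False by simp
    qed
  qed
  then show "path_epoch p k = e k" by (simp add: path_epoch_def)
qed

lemma measurable_departures [measurable (raw)]:
  assumes a [measurable]: "\<And>i. (\<lambda>x. a x i) \<in> borel_measurable N" and d [measurable]: "\<And>i. (\<lambda>x. d x i) \<in> borel_measurable N"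
  shows "(\<lambda>x. departures (a x) (d x) k) \<in> measurable N (count_space UNIV)"
proof (induction k)
  case (Suc k)
  note [measurable] = Suc
  have [measurable]: "(\<lambda>x. a x (Suc (departures (a x) (d x) k))) \<in> borel_measurable N"
    by (rule measurable_compose_countable[of "\<lambda>i x. a x (Suc i)"]) (use Suc in auto)
  show ?case unfolding departures.simps by measurable
qed simp

lemma measurable_departure_index [measurable (raw)]:
  assumes [measurable]: "\<And>i. (\<lambda>x. a x i) \<in> borel_measurable N" "\<And>i. (\<lambda>x. d x i) \<in> borel_measurable N"
  shows "(\<lambda>x. departure_index (a x) (d x) n) \<in> measurable N (count_space UNIV)"
  unfolding departure_index_def by measurable

context ml_renewal
begin

section \<open>Residual life after a random departure\<close>

lemma residual_tail_nn_integral: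
  assumes "T \<ge> 0" "t \<ge> 0"
  shows "(\<integral>\<^sup>+z. (if residual_exceeds t T z then 1 else 0) \<partial>S) = ennreal (residual_tail \<beta> \<mu> t T)"
proof -
  have "(\<integral>\<^sup>+z. (if residual_exceeds t T z then 1 else 0) \<partial>S) = (\<integral>\<^sup>+z. indicator {z \<in> space S. residual_exceeds t T z} z \<partial>S)"
    by (intro nn_integral_cong) (auto simp: indicator_def)
  then show ?thesis by (simp add: residual_tail_eq[OF assms] P.emeasure_eq_measure)
qed

text \<open>Measurability in T comes from the probabilistic representation, an integral of a jointly
  measurable event. Truncation at 0 keeps T where that representation holds.\<close>

lemma measurable_residual_tail:
  assumes "t \<ge> 0"
  shows "(\<lambda>T. residual_tail \<beta> \<mu> t (max T 0)) \<in> borel_measurable borel"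
proof -
  have "(\<lambda>T. enn2real (\<integral>\<^sup>+z. (if residual_exceeds t (max T 0) z then 1 else 0) \<partial>S)) \<in> borel_measurable borel"
    by measurable
  moreover have "residual_tail \<beta> \<mu> t (max T 0) \<ge> 0" for T
    using assms by (subst residual_tail_eq) auto
  ultimately show ?thesis using assms by (simp add: residual_tail_nn_integral)
qed

text \<open>Only epoch 0 lies at or before time 0, so the residual life there is the first gap. This
  covers an arrival before the previous departure.\<close>

lemma residual_tail_0:
  assumes "t \<ge> 0"
  shows "residual_tail \<beta> \<mu> t 0 = mittag_leffler \<beta> (- \<mu> * t powr \<beta>)"
proof -
  have "ennreal (residual_tail \<beta> \<mu> t 0) = (\<integral>\<^sup>+z. (if residual_exceeds t 0 z then 1 else 0) \<partial>S)"
    using assms by (simp add: residual_tail_nn_integral)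
  also have "\<dots> = (\<integral>\<^sup>+z. indicator {t<..} (z 0) \<partial>S)"
  proof (rule nn_integral_cong_AE, use AE_component_pos in eventually_elim)
    case (elim z)
    have "epoch z j \<le> 0 \<longleftrightarrow> j = 0" for j
      using strict_mono_less[OF strict_mono_epoch[of z], of 0 j] elim by (auto simp: not_less[symmetric])
    then have "residual_exceeds t 0 z \<longleftrightarrow> t < z 0"
      by (simp add: residual_exceeds_def epoch_Suc)
    then show ?case by (simp add: indicator_def)
  qed
  also have "\<dots> = (\<integral>\<^sup>+y. indicator {t<..} y \<partial>\<nu>)"
    by (rule nn_integral_component) measurable
  also have "\<dots> = ennreal (tail t)"
    using assms by (simp add: sets_law emeasure_greaterThan)
  finally have "ennreal (residual_tail \<beta> \<mu> t 0) = ennreal (tail t)" .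
  then have "residual_tail \<beta> \<mu> t 0 = tail t"
    using assms tail_nonneg[of t] by (subst (asm) ennreal_inj) (auto simp: residual_tail_eq)
  then show ?thesis by (simp add: tail_def)
qed

text \<open>Resampling all gaps from the \<open>k\<close>-th on leaves the law of the sequence unchanged.\<close>

lemma nn_integral_residual_after:
  fixes A :: "(nat \<Rightarrow> real) measure"
  assumes A: "sigma_finite_measure A" and sets_A [measurable_cong]: "sets A = sets (\<Pi>\<^sub>M i\<in>UNIV. borel)"
    and H [measurable]: "case_prod H \<in> borel_measurable (A \<Otimes>\<^sub>M S)"
    and T [measurable]: "case_prod T \<in> borel_measurable (A \<Otimes>\<^sub>M S)"
    and T_nonneg: "\<And>a z. T a z \<ge> 0" and t: "t \<ge> 0"
    and H_past: "\<And>a z z'. H a (comb_seq k z z') = H a z" and T_past: "\<And>a z z'. T a (comb_seq k z z') = T a z"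
  shows "(\<integral>\<^sup>+p. H (fst p) (snd p) * (if residual_exceeds t (T (fst p) (snd p)) (\<lambda>i. snd p (k + i)) then 1 else 0) \<partial>(A \<Otimes>\<^sub>M S)) =
    (\<integral>\<^sup>+p. H (fst p) (snd p) * ennreal (residual_tail \<beta> \<mu> t (T (fst p) (snd p))) \<partial>(A \<Otimes>\<^sub>M S))"
    (is "?lhs = ?rhs")
proof -
  interpret A: sigma_finite_measure A by fact
  interpret AS: pair_sigma_finite A S ..
  let ?r = "\<lambda>T z. if residual_exceeds t T z then 1 else 0 :: ennreal"
  have [measurable]: "(\<lambda>p. \<lambda>i. snd p (k + i)) \<in> measurable (A \<Otimes>\<^sub>M S) (\<Pi>\<^sub>M i\<in>UNIV. borel)"
    by (rule measurable_PiM_single') (auto simp: space_pair_measure)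
  have H' [measurable]: "(\<lambda>p. H (fst p) (snd p)) \<in> borel_measurable (A \<Otimes>\<^sub>M S)"
    and T' [measurable]: "(\<lambda>p. T (fst p) (snd p)) \<in> borel_measurable (A \<Otimes>\<^sub>M S)"
    using H T by (simp_all add: case_prod_beta)
  have res [measurable]: "(\<lambda>p. residual_tail \<beta> \<mu> t (T (fst p) (snd p))) \<in> borel_measurable (A \<Otimes>\<^sub>M S)"
    using measurable_compose[OF T' measurable_residual_tail[OF t]] T_nonneg by (simp add: max_absorb1)
  have "?lhs = (\<integral>\<^sup>+a. \<integral>\<^sup>+z. H a z * ?r (T a z) (\<lambda>i. z (k + i)) \<partial>S \<partial>A)"
    by (subst P.nn_integral_fst[symmetric]) simp_all
  also have "\<dots> = (\<integral>\<^sup>+a. \<integral>\<^sup>+z. H a z * ennreal (residual_tail \<beta> \<mu> t (T a z)) \<partial>S \<partial>A)"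
  proof (rule nn_integral_cong)
    fix a assume a: "a \<in> space A"
    have Ha [measurable]: "H a \<in> borel_measurable S" "T a \<in> borel_measurable S"
      using measurable_compose[OF measurable_Pair1'[OF a] H] measurable_compose[OF measurable_Pair1'[OF a] T]
      by simp_all
    have [measurable]: "(\<lambda>z. \<lambda>i. z (k + i)) \<in> measurable S (\<Pi>\<^sub>M i\<in>UNIV. borel)"
      by (rule measurable_PiM_single') auto
    have "(\<integral>\<^sup>+z. H a z * ?r (T a z) (\<lambda>i. z (k + i)) \<partial>S) =
      (\<integral>\<^sup>+z. \<integral>\<^sup>+z'. H a (comb_seq k z z') * ?r (T a (comb_seq k z z')) (\<lambda>i. comb_seq k z z' (k + i)) \<partial>S \<partial>S)"
      by (rule nn_integral_comb_seq) measurable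
    \<comment> \<open>\<open>H\<close> and \<open>T\<close> see only the past \<open>z\<close>, the
      residual life only the fresh sequence \<open>z'\<close>.\<close>
    also have "\<dots> = (\<integral>\<^sup>+z. \<integral>\<^sup>+z'. H a z * ?r (T a z) z' \<partial>S \<partial>S)"
      unfolding H_past T_past by (simp add: comb_seq_def)
    also have "\<dots> = (\<integral>\<^sup>+z. H a z * ennreal (residual_tail \<beta> \<mu> t (T a z)) \<partial>S)"
    proof (rule nn_integral_cong)
      fix z
      have "(\<integral>\<^sup>+z'. H a z * ?r (T a z) z' \<partial>S) = H a z * (\<integral>\<^sup>+z'. ?r (T a z) z' \<partial>S)"
        by (rule nn_integral_cmult) measurable
      then show "(\<integral>\<^sup>+z'. H a z * ?r (T a z) z' \<partial>S) = H a z * ennreal (residual_tail \<beta> \<mu> t (T a z))"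
        using residual_tail_nn_integral[OF T_nonneg t] by simp
    qed
    finally show "(\<integral>\<^sup>+z. H a z * ?r (T a z) (\<lambda>i. z (k + i)) \<partial>S) =
      (\<integral>\<^sup>+z. H a z * ennreal (residual_tail \<beta> \<mu> t (T a z)) \<partial>S)" .
  qed
  also have "\<dots> = ?rhs"
    by (subst P.nn_integral_fst[symmetric]) simp_all
  finally show ?thesis .
qed

text \<open>A strong Markov argument: the integral is split by the value of the random index
  \<open>K\<close>, each piece is treated with a fixed \<open>k\<close>, and the pieces are put
  together again.\<close>

lemma nn_integral_service:
  fixes A :: "(nat \<Rightarrow> real) measure" and n :: nat
  defines "K \<equiv> \<lambda>p. departure_index (fst p) (epoch (snd p)) n"
  defines "D \<equiv> \<lambda>p. epoch (snd p) (K p)"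
  defines "T \<equiv> \<lambda>p. max (fst p (Suc n) - D p) 0"
  assumes A: "sigma_finite_measure A" and sets_A [measurable_cong]: "sets A = sets (\<Pi>\<^sub>M i\<in>UNIV. borel)"
    and ex: "AE p in A \<Otimes>\<^sub>M S. \<exists>k. departures (fst p) (epoch (snd p)) k = n"
    and C [measurable]: "C \<in> sets (borel \<Otimes>\<^sub>M borel)" and t: "t \<ge> 0"
  shows "(\<integral>\<^sup>+p. indicator C (fst p (Suc n), D p) *
      (if residual_exceeds t (T p) (\<lambda>i. snd p (K p + i)) then 1 else 0) \<partial>(A \<Otimes>\<^sub>M S)) =
    (\<integral>\<^sup>+p. indicator C (fst p (Suc n), D p) * ennreal (residual_tail \<beta> \<mu> t (T p)) \<partial>(A \<Otimes>\<^sub>M S))"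
proof -
  \<comment> \<open>The event that \<open>K\<close> equals \<open>k\<close>, spelled out through
    indices up to \<open>k\<close>; it therefore depends on the arrivals and the first
    \<open>k\<close> gaps only, and is unaffected by resampling.\<close>
  define idx where "idx k a z \<longleftrightarrow> departures a (epoch z) k = n \<and> (\<forall>i<k. departures a (epoch z) i \<noteq> n)" for k a z
  define H where "H k a z = indicator C (a (Suc n), epoch z k) * (if idx k a z then 1 else 0 :: ennreal)"
    for k and a z :: "nat \<Rightarrow> real"
  define U where "U k a z = max (a (Suc n) - epoch z k) 0" for k and a z :: "nat \<Rightarrow> real"
  let ?f = "\<lambda>k p. (if residual_exceeds t (U k (fst p) (snd p)) (\<lambda>i. snd p (k + i)) then 1 else 0 :: ennreal)"
  let ?g = "\<lambda>k p. ennreal (residual_tail \<beta> \<mu> t (U k (fst p) (snd p)))"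
  have idx_iff: "idx k (fst p) (snd p) \<longleftrightarrow> k = K p" if "\<exists>k. departures (fst p) (epoch (snd p)) k = n" for k p
  proof -
    have "departures (fst p) (epoch (snd p)) (K p) = n"
      unfolding K_def departure_index_def using that by (rule LeastI_ex)
    moreover have "departures (fst p) (epoch (snd p)) i \<noteq> n" if "i < K p" for i
      using not_less_Least that unfolding K_def departure_index_def by blast
    ultimately show ?thesis unfolding idx_def by (metis linorder_neqE_nat)
  qed
  have split: "(\<integral>\<^sup>+p. indicator C (fst p (Suc n), D p) * F (K p) p \<partial>(A \<Otimes>\<^sub>M S)) =
      (\<Sum>k. \<integral>\<^sup>+p. H k (fst p) (snd p) * F k p \<partial>(A \<Otimes>\<^sub>M S))"
    if [measurable]: "\<And>k. F k \<in> borel_measurable (A \<Otimes>\<^sub>M S)" for F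
  proof -
    have "(\<integral>\<^sup>+p. indicator C (fst p (Suc n), D p) * F (K p) p \<partial>(A \<Otimes>\<^sub>M S)) =
      (\<integral>\<^sup>+p. (\<Sum>k. H k (fst p) (snd p) * F k p) \<partial>(A \<Otimes>\<^sub>M S))"
    proof (rule nn_integral_cong_AE, use ex in eventually_elim)
      case (elim p)
      have "(\<Sum>k. H k (fst p) (snd p) * F k p) = H (K p) (fst p) (snd p) * F (K p) p"
        by (rule suminf_eq_single) (simp add: H_def idx_iff[OF elim])
      then show ?case by (simp add: H_def idx_iff[OF elim] D_def)
    qed
    also have "\<dots> = (\<Sum>k. \<integral>\<^sup>+p. H k (fst p) (snd p) * F k p \<partial>(A \<Otimes>\<^sub>M S))"
      unfolding H_def idx_def by (rule nn_integral_suminf) measurable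
    finally show ?thesis .
  qed
  have Hm: "case_prod (H k) \<in> borel_measurable (A \<Otimes>\<^sub>M S)" and Um: "case_prod (U k) \<in> borel_measurable (A \<Otimes>\<^sub>M S)" for k
    unfolding H_def U_def idx_def case_prod_beta by measurable
  have past: "epoch (comb_seq k z z') i = epoch z i" if "i \<le> k" for k i z z'
    using that by (intro epoch_cong) (simp add: comb_seq_less)
  have "departures a (epoch (comb_seq k z z')) i = departures a (epoch z) i" if "i \<le> k" for a k i z z'
    using that by (intro departures_cong past) simp
  then have H_past: "H k a (comb_seq k z z') = H k a z" and U_past: "U k a (comb_seq k z z') = U k a z" for k a z z'
    by (simp_all add: H_def U_def idx_def past)
  have [measurable]: "(\<lambda>p. \<lambda>i. snd p (k + i)) \<in> measurable (A \<Otimes>\<^sub>M S) (\<Pi>\<^sub>M i\<in>UNIV. borel)" for k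
    by (rule measurable_PiM_single') (auto simp: space_pair_measure)
  have [measurable]: "?f k \<in> borel_measurable (A \<Otimes>\<^sub>M S)" for k
    unfolding U_def by measurable
  have [measurable]: "(\<lambda>p. residual_tail \<beta> \<mu> t (U k (fst p) (snd p))) \<in> borel_measurable (A \<Otimes>\<^sub>M S)" for k
    unfolding U_def by (rule measurable_compose[OF _ measurable_residual_tail[OF t]]) measurable
  have "(\<integral>\<^sup>+p. indicator C (fst p (Suc n), D p) * ?f (K p) p \<partial>(A \<Otimes>\<^sub>M S)) =
      (\<Sum>k. \<integral>\<^sup>+p. H k (fst p) (snd p) * ?f k p \<partial>(A \<Otimes>\<^sub>M S))"
    by (rule split) measurable
  also have "\<dots> = (\<Sum>k. \<integral>\<^sup>+p. H k (fst p) (snd p) * ?g k p \<partial>(A \<Otimes>\<^sub>M S))"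
    by (intro suminf_cong nn_integral_residual_after A sets_A Hm Um t H_past U_past) (simp add: U_def)
  also have "\<dots> = (\<integral>\<^sup>+p. indicator C (fst p (Suc n), D p) * ?g (K p) p \<partial>(A \<Otimes>\<^sub>M S))"
    by (rule split[symmetric]) measurable
  finally show ?thesis by (simp add: U_def T_def D_def)
qed

end

section \<open>Conditional probability in the completed space\<close>

lemma measurable_completion_AE:
  assumes f: "f \<in> measurable M N" and ae: "AE x in M. f x = g x" and g: "g \<in> space M \<rightarrow> space N"
  shows "g \<in> measurable (completion M) N"
proof (rule measurableI)
  fix A assume A: "A \<in> sets N"
  have [measurable]: "f -` A \<inter> space M \<in> sets (completion M)"
    using f A by (intro sets_completionI_sets measurable_sets)
  have 1: "{x \<in> space (completion M). f x \<noteq> g x} \<in> sets (completion M)"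
    using sets_completion_AE[where M = M and P = "\<lambda>x. f x \<noteq> g x"] ae by (simp add: pred_def)
  have 2: "{x \<in> space (completion M). f x \<noteq> g x \<and> g x \<in> A} \<in> sets (completion M)"
  proof -
    have "AE x in M. \<not> (f x \<noteq> g x \<and> g x \<in> A)" using ae by eventually_elim simp
    then show ?thesis using sets_completion_AE by (simp only: pred_def)
  qed
  have "g -` A \<inter> space (completion M) =
      ((f -` A \<inter> space M) - {x \<in> space (completion M). f x \<noteq> g x}) \<union>
      {x \<in> space (completion M). f x \<noteq> g x \<and> g x \<in> A}"
    by auto
  then show "g -` A \<inter> space (completion M) \<in> sets (completion M)"
    using 1 2 by simp
qed (use g in auto)

text \<open>\<open>X'\<close> and \<open>P'\<close> are versions of \<open>X\<close> and \<open>P\<close> that are measurable without completing \<open>M\<close>.\<close>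

lemma cond_prob_given_eqI:
  fixes X X' :: "'a \<Rightarrow> 'b::topological_space" and \<phi> :: "'b \<Rightarrow> real"
  assumes "prob_space M"
    and X' [measurable]: "X' \<in> borel_measurable M" and P' [measurable]: "Measurable.pred M P'"
    and ae: "AE \<omega> in M. X \<omega> = X' \<omega> \<and> (P \<omega> \<longleftrightarrow> P' \<omega>)"
    and \<phi> [measurable]: "\<phi> \<in> borel_measurable borel" and \<phi>_bounds: "\<And>x. 0 \<le> \<phi> x" "\<And>x. \<phi> x \<le> 1"
    and eq: "\<And>C. C \<in> sets borel \<Longrightarrow>
      (\<integral>\<^sup>+\<omega>. indicator C (X' \<omega>) * (if P' \<omega> then 1 else 0) \<partial>M) = (\<integral>\<^sup>+\<omega>. indicator C (X' \<omega>) * ennreal (\<phi> (X' \<omega>)) \<partial>M)"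
  shows "AE \<omega> in M. cond_prob_given M X P \<omega> = \<phi> (X \<omega>)"
proof -
  interpret prob_space M by fact
  let ?M = "completion M" and ?F = "vimage_algebra (space M) X borel"
  let ?f = "indicator {\<omega> \<in> space M. P \<omega>} :: 'a \<Rightarrow> real" and ?g = "\<lambda>\<omega>. \<phi> (X \<omega>)"
  have X [measurable]: "X \<in> borel_measurable ?M"
    using X' ae by (intro measurable_completion_AE[of X']) auto
  have P [measurable]: "Measurable.pred ?M P"
    using P' ae by (intro measurable_completion_AE[of P']) auto
  have sets_F: "sets ?F = {X -` C \<inter> space M |C. C \<in> sets borel}"
    by (rule sets_vimage_algebra2) simp
  have sub: "subalgebra ?M ?F"
    unfolding subalgebra_def sets_F using measurable_sets[OF X] by auto
  interpret C: finite_measure ?M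
    by (rule finite_measureI) (simp add: emeasure_space_1)
  interpret S: finite_measure_subalgebra ?M ?F
    by unfold_locales (rule sub)
  have f [measurable]: "?f \<in> borel_measurable ?M"
    using P by (intro borel_measurable_indicator) (simp add: pred_def)
  have "AE \<omega> in ?M. real_cond_exp ?M ?F ?f \<omega> = ?g \<omega>"
  \<comment> \<open>The events to test are the preimages of Borel sets under \<open>X\<close>.
    Integrals over them are moved from the completion to \<open>M\<close>, where \<open>X'\<close>
    and \<open>P'\<close> may stand in for \<open>X\<close> and \<open>P\<close>.\<close>
  proof (rule S.real_cond_exp_charact)
    fix A assume "A \<in> sets ?F"
    then obtain C where C [measurable]: "C \<in> sets borel" and A: "A = X -` C \<inter> space M"
      unfolding sets_F by blast
    have [measurable]: "A \<in> sets ?M" unfolding A using measurable_sets[OF X C] by simp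
    have "(\<integral>\<omega>\<in>A. ?f \<omega> \<partial>?M) = enn2real (\<integral>\<^sup>+\<omega>. ennreal (indicator A \<omega> *\<^sub>R ?f \<omega>) \<partial>?M)"
      unfolding set_lebesgue_integral_def by (rule integral_eq_nn_integral) auto
    also have "(\<integral>\<^sup>+\<omega>. ennreal (indicator A \<omega> *\<^sub>R ?f \<omega>) \<partial>?M) = (\<integral>\<^sup>+\<omega>. ennreal (indicator A \<omega> *\<^sub>R ?f \<omega>) \<partial>M)"
      by (rule nn_integral_completion)
    also have "\<dots> = (\<integral>\<^sup>+\<omega>. indicator C (X' \<omega>) * (if P' \<omega> then 1 else 0) \<partial>M)"
    proof (rule nn_integral_cong_AE, use ae AE_space in eventually_elim)
      case (elim \<omega>)
      then show ?case by (auto simp: A indicator_def)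
    qed
    also have "\<dots> = (\<integral>\<^sup>+\<omega>. indicator C (X' \<omega>) * ennreal (\<phi> (X' \<omega>)) \<partial>M)"
      by (rule eq) fact
    also have "\<dots> = (\<integral>\<^sup>+\<omega>. ennreal (indicator A \<omega> *\<^sub>R ?g \<omega>) \<partial>M)"
    proof (rule nn_integral_cong_AE, use ae AE_space in eventually_elim)
      case (elim \<omega>)
      then show ?case by (auto simp: A indicator_def)
    qed
    also have "\<dots> = (\<integral>\<^sup>+\<omega>. ennreal (indicator A \<omega> *\<^sub>R ?g \<omega>) \<partial>?M)"
      by (rule nn_integral_completion[symmetric])
    also have "enn2real \<dots> = (\<integral>\<omega>\<in>A. ?g \<omega> \<partial>?M)"
      unfolding set_lebesgue_integral_def
      by (rule integral_eq_nn_integral[symmetric]) (auto simp: \<phi>_bounds)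
    finally show "(\<integral>\<omega>\<in>A. ?f \<omega> \<partial>?M) = (\<integral>\<omega>\<in>A. ?g \<omega> \<partial>?M)" .
  next
    show "integrable ?M ?f"
      by (rule C.integrable_const_bound[of _ 1]) (auto simp: indicator_def)
    show "integrable ?M ?g"
      by (rule C.integrable_const_bound[of _ 1]) (auto simp: \<phi>_bounds)
    show "?g \<in> borel_measurable ?F"
      by (rule measurable_compose[OF measurable_vimage_algebra1 \<phi>]) simp
  qed
  then show ?thesis
    unfolding cond_prob_given_def AE_completion_iff .
qed

text \<open>By Fubini the first sequence may be held fixed. It offers countably many values, each
  avoided almost surely by every epoch after the origin.\<close>

lemma (in ml_renewal) AE_pair_no_ties:
  fixes A :: "(nat \<Rightarrow> real) measure"
  assumes A: "sigma_finite_measure A" and sets_A [measurable_cong]: "sets A = sets (\<Pi>\<^sub>M i\<in>UNIV. borel)"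
  shows "AE p in A \<Otimes>\<^sub>M S. \<forall>i j. j > 0 \<longrightarrow> fst p i \<noteq> epoch (snd p) j"
proof -
  interpret A: sigma_finite_measure A by fact
  interpret AS: pair_sigma_finite A S ..
  show ?thesis
  proof (rule AS.AE_pair_measure)
    show "AE a in A. AE z in S. \<forall>i j. j > 0 \<longrightarrow> fst (a, z) i \<noteq> epoch (snd (a, z)) j"
    proof (rule AE_I2)
      fix a :: "nat \<Rightarrow> real"
      have 0: "AE z in S. j > 0 \<longrightarrow> a i \<noteq> epoch z j" for i j
      proof (cases "j > 0")
        case True
        from AE_epoch_neq[OF this, of "a i"] show ?thesis by eventually_elim (rule impI, rule not_sym)
      qed simp
      then show "AE z in S. \<forall>i j. j > 0 \<longrightarrow> fst (a, z) i \<noteq> epoch (snd (a, z)) j"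
        unfolding fst_conv snd_conv by (intro AE_all_countable[THEN iffD2] allI 0)
    qed
  next
    have [measurable]: "(\<lambda>p. fst p i) \<in> borel_measurable (A \<Otimes>\<^sub>M S)" "(\<lambda>p. epoch (snd p) i) \<in> borel_measurable (A \<Otimes>\<^sub>M S)" for i
      by measurable
    have 1: "{p \<in> space (A \<Otimes>\<^sub>M S). fst p i = epoch (snd p) j} \<in> sets (A \<Otimes>\<^sub>M S)" for i j
      by (rule borel_measurable_eq) fact+
    show "{p \<in> space (A \<Otimes>\<^sub>M S). \<forall>i j. j > 0 \<longrightarrow> fst p i \<noteq> epoch (snd p) j} \<in> sets (A \<Otimes>\<^sub>M S)"
      by (intro sets.sets_Collect_countable_All sets.sets_Collect_imp sets.sets_Collect_neg 1 sets.sets_Collect_const)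
  qed
qed

theorem proposition2p9:
  fixes M :: "'a measure" and \<alpha> \<beta> lam \<mu> t :: real and n :: nat
    and Q :: "real \<Rightarrow> 'a \<Rightarrow> real"
  assumes "prob_space M"
    and "0 < \<alpha>" "\<alpha> \<le> 1" "0 < \<beta>" "\<beta> \<le> 1" "0 < lam" "0 < \<mu>"
    and "restless_ML_queue M \<alpha> \<beta> lam \<mu> Q"
    and "n \<ge> 1" "t \<ge> 0"
  shows "AE \<omega> in M.
    cond_prob_given M (\<lambda>\<omega>. (arrival_time Q n \<omega>, departure_time Q (n - 1) \<omega>))
        (\<lambda>\<omega>. service_time Q n \<omega> > t) \<omega> =
      (if arrival_time Q n \<omega> < departure_time Q (n - 1) \<omega>
       then mittag_leffler \<beta> (- \<mu> * t powr \<beta>)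
       else residual_tail \<beta> \<mu> t (arrival_time Q n \<omega> - departure_time Q (n - 1) \<omega>))"
proof -
  interpret prob_space M by fact
  obtain m where n: "n = Suc m" using \<open>n \<ge> 1\<close> by (cases n) auto
  obtain Na Nd where Na: "fractional_poisson_process M \<alpha> lam Na" and Nd: "fractional_poisson_process M \<beta> \<mu> Nd"
    and indep: "indep_var
          (Pi\<^sub>M {0..} (\<lambda>_. count_space UNIV)) (\<lambda>\<omega>. \<lambda>t\<in>{0..}. Na t \<omega>)
          (Pi\<^sub>M {0..} (\<lambda>_. count_space UNIV)) (\<lambda>\<omega>. \<lambda>t\<in>{0..}. Nd t \<omega>)"
    and Q: "\<forall>\<omega>\<in>space M. \<forall>t\<ge>0. Q t \<omega> = skorokhod_reflection (\<lambda>s. real (Na s \<omega>) - real (Nd s \<omega>)) t"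
    using \<open>restless_ML_queue M \<alpha> \<beta> lam \<mu> Q\<close> unfolding restless_ML_queue_def by blast
  obtain \<nu>a Za where ren_a: "ml_renewal \<nu>a \<alpha> lam" and Za: "\<And>i. Za i \<in> borel_measurable M"
    and law_a: "distr M (\<Pi>\<^sub>M i\<in>UNIV. borel) (\<lambda>\<omega> i. Za i \<omega>) = (\<Pi>\<^sub>M i\<in>UNIV. \<nu>a)"
    and Na_eq: "AE \<omega> in M. \<forall>t\<ge>0. Na t \<omega> = Max {k. epoch (\<lambda>i. Za i \<omega>) k \<le> t}"
    using fractional_poisson_process_renewal[OF \<open>prob_space M\<close> Na \<open>0 < \<alpha>\<close> \<open>0 < lam\<close>] by blast
  obtain \<nu> Z where ren_d: "ml_renewal \<nu> \<beta> \<mu>" and Z: "\<And>i. Z i \<in> borel_measurable M"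
    and law_d: "distr M (\<Pi>\<^sub>M i\<in>UNIV. borel) (\<lambda>\<omega> i. Z i \<omega>) = (\<Pi>\<^sub>M i\<in>UNIV. \<nu>)"
    and Nd_eq: "AE \<omega> in M. \<forall>t\<ge>0. Nd t \<omega> = Max {k. epoch (\<lambda>i. Z i \<omega>) k \<le> t}"
    using fractional_poisson_process_renewal[OF \<open>prob_space M\<close> Nd \<open>0 < \<beta>\<close> \<open>0 < \<mu>\<close>] by blast
  interpret A: ml_renewal \<nu>a \<alpha> lam by fact
  interpret R: ml_renewal \<nu> \<beta> \<mu> by fact
  have Za_meas: "(\<lambda>\<omega> i. Za i \<omega>) \<in> measurable M (\<Pi>\<^sub>M i\<in>UNIV. borel)"
    and Z_meas: "(\<lambda>\<omega> i. Z i \<omega>) \<in> measurable M (\<Pi>\<^sub>M i\<in>UNIV. borel)"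
    using Za Z by (auto intro!: measurable_PiM_single')
  have seq_a: "AE \<omega> in M. epoch_sequence (epoch (\<lambda>i. Za i \<omega>))"
    using A.AE_epoch_sequence unfolding law_a[symmetric] by (rule AE_distrD[OF Za_meas])
  have seq_d: "AE \<omega> in M. epoch_sequence (epoch (\<lambda>i. Z i \<omega>))"
    using R.AE_epoch_sequence unfolding law_d[symmetric] by (rule AE_distrD[OF Z_meas])
  define pa where "pa \<omega> = (\<lambda>t\<in>{0..}. Na t \<omega>)" for \<omega>
  define pd where "pd \<omega> = (\<lambda>t\<in>{0..}. Nd t \<omega>)" for \<omega>
  define gaps :: "(nat \<Rightarrow> real) \<Rightarrow> nat \<Rightarrow> real" where "gaps e i = e (Suc i) - e i" for e i
  have gaps_epoch: "gaps (epoch z) = z" for z by (simp add: gaps_def epoch_Suc fun_eq_iff)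
  have gaps_meas: "gaps \<in> measurable (\<Pi>\<^sub>M i\<in>UNIV. borel) (\<Pi>\<^sub>M i\<in>UNIV. borel)"
    unfolding gaps_def by (rule measurable_PiM_single') auto
  \<comment> \<open>Arrivals are kept as epochs, opportunities as gaps, because only the latter are
    resampled. Both are functions of the counting paths, hence independent, and agree almost surely
    with the original data.\<close>
  define Xa where "Xa \<omega> = path_epoch (pa \<omega>)" for \<omega>
  define Xd where "Xd \<omega> = gaps (path_epoch (pd \<omega>))" for \<omega>
  have Xa_eq: "AE \<omega> in M. Xa \<omega> = epoch (\<lambda>i. Za i \<omega>)"
    using seq_a Na_eq unfolding Xa_def by eventually_elim (auto intro!: path_epoch_eq simp: pa_def)
  have Xd_eq: "AE \<omega> in M. Xd \<omega> = (\<lambda>i. Z i \<omega>)"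
    using seq_d Nd_eq
  proof eventually_elim
    case (elim \<omega>)
    then have "path_epoch (pd \<omega>) = epoch (\<lambda>i. Z i \<omega>)" by (intro path_epoch_eq) (auto simp: pd_def)
    then show ?case by (simp add: Xd_def gaps_epoch)
  qed
  have indep': "indep_var (\<Pi>\<^sub>M i\<in>UNIV. borel) Xa (\<Pi>\<^sub>M i\<in>UNIV. borel) Xd"
    using indep_var_compose[OF indep measurable_path_epoch measurable_comp[OF measurable_path_epoch gaps_meas]]
    by (simp add: Xa_def[abs_def] Xd_def[abs_def] pa_def[abs_def] pd_def[abs_def] comp_def)
  have Xa [measurable]: "Xa \<in> measurable M (\<Pi>\<^sub>M i\<in>UNIV. borel)"
    and Xd [measurable]: "Xd \<in> measurable M (\<Pi>\<^sub>M i\<in>UNIV. borel)"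
    using indep_var_rv1[OF indep'] indep_var_rv2[OF indep'] .
  define A where "A = distr M (\<Pi>\<^sub>M i\<in>UNIV. borel) Xa"
  have sets_A [measurable_cong]: "sets A = sets (\<Pi>\<^sub>M i\<in>UNIV. borel)" by (simp add: A_def)
  interpret LA: prob_space A unfolding A_def by (rule prob_space_distr) (rule Xa)
  interpret AS: pair_sigma_finite A "\<Pi>\<^sub>M i\<in>(UNIV :: nat set). \<nu>" ..
  let ?P = "A \<Otimes>\<^sub>M (\<Pi>\<^sub>M i\<in>(UNIV :: nat set). \<nu>)"
  have "distr M (\<Pi>\<^sub>M i\<in>UNIV. borel) Xd = (\<Pi>\<^sub>M i\<in>UNIV. \<nu>)"
    unfolding law_d[symmetric] using Xd_eq Z_meas by (intro distr_cong_AE) auto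
  then have joint: "distr M ((\<Pi>\<^sub>M i\<in>UNIV. borel) \<Otimes>\<^sub>M (\<Pi>\<^sub>M i\<in>UNIV. borel)) (\<lambda>\<omega>. (Xa \<omega>, Xd \<omega>)) = ?P"
    using indep_var_distribution_eq[THEN iffD1, OF indep'] by (simp add: A_def)
  have X_meas [measurable]: "(\<lambda>\<omega>. (Xa \<omega>, Xd \<omega>)) \<in> measurable M ((\<Pi>\<^sub>M i\<in>UNIV. borel) \<Otimes>\<^sub>M (\<Pi>\<^sub>M i\<in>UNIV. borel))"
    by measurable
  have "AE p in ?P. \<forall>i j. j > 0 \<longrightarrow> fst p i \<noteq> epoch (snd p) j"
    by (rule R.AE_pair_no_ties[OF LA.sigma_finite_measure_axioms sets_A])
  then have no_ties: "AE \<omega> in M. \<forall>i j. j > 0 \<longrightarrow> Xa \<omega> i \<noteq> epoch (Xd \<omega>) j"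
    using AE_distrD[OF X_meas, unfolded joint, of "\<lambda>p. \<forall>i j. j > 0 \<longrightarrow> fst p i \<noteq> epoch (snd p) j"]
    unfolding fst_conv snd_conv by blast
  have path: "AE \<omega> in M. queue_path (Xa \<omega>) (epoch (Xd \<omega>)) (\<lambda>t. Na t \<omega>) (\<lambda>t. Nd t \<omega>) Q \<omega>"
    using no_ties seq_a seq_d Xa_eq Xd_eq Na_eq Nd_eq AE_space
  proof eventually_elim
    case (elim \<omega>)
    then show ?case using Q by (intro queue_path.intro) auto
  qed
  define K where "K p = departure_index (fst p) (epoch (snd p)) m" for p :: "(nat \<Rightarrow> real) \<times> (nat \<Rightarrow> real)"
  define D where "D p = epoch (snd p) (K p)" for p
  define T where "T p = max (fst p (Suc m) - D p) 0" for p
  define G where "G p \<longleftrightarrow> residual_exceeds t (T p) (\<lambda>i. snd p (K p + i))" for p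
  define X' where "X' p = (fst p (Suc m), D p)" for p
  let ?B = "(\<Pi>\<^sub>M i\<in>UNIV. borel) \<Otimes>\<^sub>M (\<Pi>\<^sub>M i\<in>UNIV. borel) :: ((nat \<Rightarrow> real) \<times> (nat \<Rightarrow> real)) measure"
  have K_meas [measurable]: "K \<in> measurable ?B (count_space UNIV)"
    unfolding K_def[abs_def] by measurable
  have D_meas [measurable]: "D \<in> borel_measurable ?B"
    unfolding D_def[abs_def] by (rule measurable_compose_countable[OF _ K_meas]) measurable
  have T_meas [measurable]: "T \<in> borel_measurable ?B"
    unfolding T_def[abs_def] by measurable
  have "(\<lambda>p. snd p (K p + i)) \<in> borel_measurable ?B" for i
    by (rule measurable_compose_countable[OF _ K_meas]) measurable
  then have [measurable]: "(\<lambda>p i. snd p (K p + i)) \<in> measurable ?B (\<Pi>\<^sub>M i\<in>UNIV. borel)"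
    by (intro measurable_PiM_single') auto
  have G_meas [measurable]: "Measurable.pred ?B G"
    unfolding G_def[abs_def] by measurable
  have X'_meas [measurable]: "X' \<in> borel_measurable ?B"
    unfolding X'_def[abs_def] borel_prod[symmetric] by measurable
  \<comment> \<open>Truncation at 0 treats both cases of the statement at once.\<close>
  define \<phi> where "\<phi> x = residual_tail \<beta> \<mu> t (max (fst x - snd x) 0)" for x :: "real \<times> real"
  have \<phi>_meas [measurable]: "\<phi> \<in> borel_measurable borel"
    unfolding \<phi>_def[abs_def] borel_prod[symmetric]
    by (rule measurable_compose[OF _ R.measurable_residual_tail[OF \<open>t \<ge> 0\<close>]]) measurable
  have \<phi>_X': "\<phi> (X' p) = residual_tail \<beta> \<mu> t (T p)" for p
    by (simp add: \<phi>_def X'_def T_def)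
  have "AE \<omega> in M. cond_prob_given M (\<lambda>\<omega>. (arrival_time Q (Suc m) \<omega>, departure_time Q m \<omega>))
      (\<lambda>\<omega>. service_time Q (Suc m) \<omega> > t) \<omega> = \<phi> (arrival_time Q (Suc m) \<omega>, departure_time Q m \<omega>)"
  proof (rule cond_prob_given_eqI[where X' = "\<lambda>\<omega>. X' (Xa \<omega>, Xd \<omega>)" and P' = "\<lambda>\<omega>. G (Xa \<omega>, Xd \<omega>)"])
    show "AE \<omega> in M. (arrival_time Q (Suc m) \<omega>, departure_time Q m \<omega>) = X' (Xa \<omega>, Xd \<omega>) \<and>
        (service_time Q (Suc m) \<omega> > t \<longleftrightarrow> G (Xa \<omega>, Xd \<omega>))"
      using path
    proof eventually_elim
      case (elim \<omega>)
      interpret queue_path "Xa \<omega>" "epoch (Xd \<omega>)" "\<lambda>t. Na t \<omega>" "\<lambda>t. Nd t \<omega>" Q \<omega> by fact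
      show ?case
        unfolding service_time_gt_iff[OF \<open>t \<ge> 0\<close>] arrival_time_eq departure_time_eq
          X'_def G_def T_def D_def K_def residual_exceeds_def epoch_shift fst_conv snd_conv
        by (intro conjI refl)
    qed
    show "(\<integral>\<^sup>+\<omega>. indicator C (X' (Xa \<omega>, Xd \<omega>)) * (if G (Xa \<omega>, Xd \<omega>) then 1 else 0) \<partial>M) =
        (\<integral>\<^sup>+\<omega>. indicator C (X' (Xa \<omega>, Xd \<omega>)) * ennreal (\<phi> (X' (Xa \<omega>, Xd \<omega>))) \<partial>M)"
      if C [measurable]: "C \<in> sets borel" for C
    proof -
      \<comment> \<open>Existence of the index is known along sample paths on \<open>M\<close>; it
        is carried to the product space through the joint law.\<close>
      have "AE \<omega> in M. \<exists>k. departures (Xa \<omega>) (epoch (Xd \<omega>)) k = m"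
        using path by eventually_elim (rule queue_path.ex_dep)
      moreover have "{p \<in> space ?B. \<exists>k. departures (fst p) (epoch (snd p)) k = m} \<in> sets ?B"
        by measurable
      ultimately have ex: "AE p in ?P. \<exists>k. departures (fst p) (epoch (snd p)) k = m"
        unfolding joint[symmetric] by (simp only: AE_distr_iff[OF X_meas] fst_conv snd_conv)
      have "(\<integral>\<^sup>+\<omega>. indicator C (X' (Xa \<omega>, Xd \<omega>)) * (if G (Xa \<omega>, Xd \<omega>) then 1 else 0) \<partial>M) =
          (\<integral>\<^sup>+p. indicator C (X' p) * (if G p then 1 else 0) \<partial>?P)"
        unfolding joint[symmetric] by (rule nn_integral_distr[symmetric]) measurable
      also have "\<dots> = (\<integral>\<^sup>+p. indicator C (X' p) * ennreal (residual_tail \<beta> \<mu> t (T p)) \<partial>?P)"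
        unfolding G_def X'_def T_def D_def K_def
        by (rule R.nn_integral_service[OF LA.sigma_finite_measure_axioms sets_A ex _ \<open>t \<ge> 0\<close>]) (subst borel_prod, rule C)
      also have "\<dots> = (\<integral>\<^sup>+p. indicator C (X' p) * ennreal (\<phi> (X' p)) \<partial>?P)"
        by (simp only: \<phi>_X')
      also have "\<dots> = (\<integral>\<^sup>+\<omega>. indicator C (X' (Xa \<omega>, Xd \<omega>)) * ennreal (\<phi> (X' (Xa \<omega>, Xd \<omega>))) \<partial>M)"
        unfolding joint[symmetric] by (rule nn_integral_distr) measurable
      finally show ?thesis .
    qed
    show "0 \<le> \<phi> x" "\<phi> x \<le> 1" for x
      using \<open>t \<ge> 0\<close> by (simp_all add: \<phi>_def R.residual_tail_eq)
  qed (fact \<open>prob_space M\<close> \<phi>_meas measurable_compose[OF X_meas X'_meas] measurable_compose[OF X_meas G_meas])+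
  \<comment> \<open>For x < y the truncated difference is 0, and \<open>residual_tail\<close> at 0
    is the Mittag-Leffler tail.\<close>
  moreover have "\<phi> (x, y) = (if x < y then mittag_leffler \<beta> (- \<mu> * t powr \<beta>) else residual_tail \<beta> \<mu> t (x - y))" for x y
    using R.residual_tail_0[OF \<open>t \<ge> 0\<close>] by (simp add: \<phi>_def)
  ultimately show ?thesis unfolding n diff_Suc_1 by (simp only:)
qed

end
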